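(* Let $d=d_1d_2d_3$ be a squarefree integer $>1$ (so $d=ab^2$ with $a=d$, $b=1$) with $d\equiv\pm1\pmod 9$, and let $L=\mathbb{Q}(\sqrt[3]{d})$. Assume there exists a principal factor $\alpha\in\mathcal{O}_L$ with $N_{L/\mathbb{Q}}(\alpha)=n=d_1d_2^2$, where $d_1,d_2,d_3$ are the canonical divisors of $d$ with respect to $n$ (so $d_1$, $d_2$, $d_3$ are the products of the primes $\ell\mid d$ with $v_\ell(n)=1,2,0$ respectively), and assume $d_2^2<d_1d_3$ and $d_1d_2<d_3^2$. (i) If $d_1^2<d_2d_3$, put $\bar\alpha=\alpha^2/d_2$. Then $L$ is an $\mathrm{M}0$-field (in particular neither $\alpha\in\mathrm{Min}(\mathcal{O}_L)$ nor $\bar\alpha\in\mathrm{Min}(\mathcal{O}_L)$) provided one of the following holds: $d_1\equiv d_2\equiv -d_3\pmod 3$ and $d_3\le2\min(d_1,d_2)$; or $d_1\equiv -d_2\equiv d_3\pmod 3$ and $d_3\le\min(\sqrt6\,d_1,2d_2)$; or $-d_1\equiv d_3\equiv d_2\pmod 3$ and $d_3\le\min(2d_1,\sqrt6\,d_2)$. (ii) If $d_2d_3<d_1^2$, put $\bar\alpha=\alpha^2/d_2$. Then $L$ is an $\mathrm{M}0$-field (in particular neither $\alpha\in\mathrm{Min}(\mathcal{O}_L)$ nor $\bar\alpha\delta/d_1\in\mathrm{Min}(\mathcal{O}_L)$) provided one of the following holds: $d_1\equiv d_2\equiv-d_3\pmod 3$, $d_1\le\sqrt6\,d_2$ and $d_3\le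 2d_2$; or $d_1\equiv-d_2\equiv d_3\pmod 3$ and $\max(d_1,d_3)\le2d_2$; or $-d_1\equiv d_3\equiv d_2\pmod 3$, $d_1\le 2d_2$ and $d_3\le\sqrt6\,d_2$.
   Context: Notation: $L\subset\mathbb{R}$, $\delta=\sqrt[3]{d}$ real, $\zeta_3$ a primitive cube root of unity, $\mathit{k}_0=\mathbb{Q}(\zeta_3)$, $\mathit{k}=L(\zeta_3)$, $\sigma$ the generator of $\mathrm{Gal}(\mathit{k}/\mathit{k}_0)$ with $\sigma(\delta)=\zeta_3\delta$; $\mathcal{O}_L$ the maximal order, $E_L$ its units, $E_L^+$ its positive units. For $\alpha\in L$, $\alpha'=\sigma(\alpha)$, $\alpha''=\sigma^2(\alpha)$ (complex conjugates). An $\alpha\in\mathcal{O}_L$ with $\alpha>0$ is a lattice minimum of $\mathcal{O}_L$ if every $\beta\in\mathcal{O}_L$ with $\beta'\beta''<\alpha'\alpha''$ and $0\le\beta<\alpha$ is $0$; $\mathrm{Min}(\mathcal{O}_L)$ is the set of these. Let $\Delta_{L/\mathbb{Q}}=\{\alpha\in L^\times:\sigma(\alpha\mathcal{O}_{\mathit{k}})=\alpha\mathcal{O}_{\mathit{k}}\}$. A principal factor is $\alpha\in\mathcal{O}_L\cap\Delta_{L/\mathbb{Q}}$ such that $\alpha\mathcal{O}_L\not\subseteq m\mathcal{O}_L$ for every integer $m>1$. $L$ is of type $\beta$ if it has a principal factor not in the subgroup generated by $E_L$, $\mathbb{Q}^\times$ and $\delta$. A field $L$ of type $\beta$ is called an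 $\mathrm{M}0$-field if $\mathrm{Min}(\mathcal{O}_L)\cap\Delta_{L/\mathbb{Q}}=E_L^+$, i.e. no lattice minimum of $\mathcal{O}_L$ other than the positive units generates an ambiguous principal ideal. *)

theory Defs
  imports Complex_Main "HOL-Algebra.Algebraic_Closure_Type" "HOL-Algebra.Generated_Fields" "HOL-Number_Theory.Cong"
    "HOL-Computational_Algebra.Squarefree"
begin

text \<open>
  The real cubic field \<open>L\<close> lives in \<^typ>\<open>real\<close>, its normal closure \<open>k = L(\<zeta>)\<close> in
  \<^typ>\<open>complex\<close>.  In all definitions \<open>\<delta>\<close> is the real cube root generating \<open>L\<close>, \<open>\<zeta>\<close> a
  primitive cube root of unity, and \<open>\<sigma>\<close> an automorphism of \<open>k\<close>; values of \<open>\<sigma>\<close> outside \<open>k\<close>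
  are never used.
\<close>

definition field_L :: "real \<Rightarrow> real set" where
  "field_L \<delta> = generate_field ring_of_type_algebra {\<delta>}"

definition field_k0 :: "complex \<Rightarrow> complex set" where
  "field_k0 \<zeta> = generate_field ring_of_type_algebra {\<zeta>}"

definition field_k :: "real \<Rightarrow> complex \<Rightarrow> complex set" where
  "field_k \<delta> \<zeta> = generate_field ring_of_type_algebra (complex_of_real ` field_L \<delta> \<union> {\<zeta>})"

definition primitive_cube_root :: "complex \<Rightarrow> bool" where
  "primitive_cube_root \<zeta> \<longleftrightarrow> \<zeta> ^ 3 = 1 \<and> \<zeta> \<noteq> 1"

definition is_sigma :: "real \<Rightarrow> complex \<Rightarrow> (complex \<Rightarrow> complex) \<Rightarrow> bool" where
  "is_sigma \<delta> \<zeta> \<sigma> \<longleftrightarrow>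
     \<sigma> \<in> ring_iso (ring_of_type_algebra\<lparr>carrier := field_k \<delta> \<zeta>\<rparr>)
                    (ring_of_type_algebra\<lparr>carrier := field_k \<delta> \<zeta>\<rparr>) \<and>
     (\<forall>x\<in>field_k0 \<zeta>. \<sigma> x = x) \<and>
     \<sigma> (complex_of_real \<delta>) = \<zeta> * complex_of_real \<delta>"

definition int_L :: "real \<Rightarrow> real set" where
  "int_L \<delta> = {x \<in> field_L \<delta>. algebraic_int x}"

definition int_k :: "real \<Rightarrow> complex \<Rightarrow> complex set" where
  "int_k \<delta> \<zeta> = {x \<in> field_k \<delta> \<zeta>. algebraic_int x}"

definition units_L :: "real \<Rightarrow> real set" where
  "units_L \<delta> = {x \<in> int_L \<delta>. \<exists>y\<in>int_L \<delta>. x * y = 1}"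

definition pos_units_L :: "real \<Rightarrow> real set" where
  "pos_units_L \<delta> = {x \<in> units_L \<delta>. x > 0}"

definition conj1 :: "(complex \<Rightarrow> complex) \<Rightarrow> real \<Rightarrow> complex" where
  "conj1 \<sigma> \<alpha> = \<sigma> (complex_of_real \<alpha>)"

definition conj2 :: "(complex \<Rightarrow> complex) \<Rightarrow> real \<Rightarrow> complex" where
  "conj2 \<sigma> \<alpha> = \<sigma> (\<sigma> (complex_of_real \<alpha>))"

definition norm_L :: "(complex \<Rightarrow> complex) \<Rightarrow> real \<Rightarrow> complex" where
  "norm_L \<sigma> \<alpha> = complex_of_real \<alpha> * conj1 \<sigma> \<alpha> * conj2 \<sigma> \<alpha>"

text \<open>
  For \<open>\<alpha> \<in> L\<close> the two conjugates are complex conjugates of each other, so their product is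
  a real number; \<^const>\<open>Re\<close> below only changes its type.
\<close>

definition lattice_minima :: "real \<Rightarrow> (complex \<Rightarrow> complex) \<Rightarrow> real set" where
  "lattice_minima \<delta> \<sigma> = {\<alpha> \<in> int_L \<delta>. \<alpha> > 0 \<and>
     (\<forall>\<beta>\<in>int_L \<delta>. Re (conj1 \<sigma> \<beta> * conj2 \<sigma> \<beta>) < Re (conj1 \<sigma> \<alpha> * conj2 \<sigma> \<alpha>) \<and>
        0 \<le> \<beta> \<and> \<beta> < \<alpha> \<longrightarrow> \<beta> = 0)}"

definition ambiguous_L :: "real \<Rightarrow> complex \<Rightarrow> (complex \<Rightarrow> complex) \<Rightarrow> real set" where
  "ambiguous_L \<delta> \<zeta> \<sigma> = {\<alpha> \<in> field_L \<delta>. \<alpha> \<noteq> 0 \<and>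
     \<sigma> ` ((\<lambda>x. complex_of_real \<alpha> * x) ` int_k \<delta> \<zeta>) = (\<lambda>x. complex_of_real \<alpha> * x) ` int_k \<delta> \<zeta>}"

definition principal_factor :: "real \<Rightarrow> complex \<Rightarrow> (complex \<Rightarrow> complex) \<Rightarrow> real \<Rightarrow> bool" where
  "principal_factor \<delta> \<zeta> \<sigma> \<alpha> \<longleftrightarrow> \<alpha> \<in> int_L \<delta> \<inter> ambiguous_L \<delta> \<zeta> \<sigma> \<and>
     (\<forall>m::int. m > 1 \<longrightarrow>
        \<not> (\<lambda>x. \<alpha> * x) ` int_L \<delta> \<subseteq> (\<lambda>x. real_of_int m * x) ` int_L \<delta>)"

definition type_beta :: "real \<Rightarrow> complex \<Rightarrow> (complex \<Rightarrow> complex) \<Rightarrow> bool" where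
  "type_beta \<delta> \<zeta> \<sigma> \<longleftrightarrow> (\<exists>\<alpha>. principal_factor \<delta> \<zeta> \<sigma> \<alpha> \<and>
     \<alpha> \<notin> generate (Multiplicative_Group.mult_of (ring_of_type_algebra\<lparr>carrier := field_L \<delta>\<rparr>))
            (units_L \<delta> \<union> (\<rat> - {0}) \<union> {\<delta>}))"

definition M0_field :: "real \<Rightarrow> complex \<Rightarrow> (complex \<Rightarrow> complex) \<Rightarrow> bool" where
  "M0_field \<delta> \<zeta> \<sigma> \<longleftrightarrow> type_beta \<delta> \<zeta> \<sigma> \<and>
     lattice_minima \<delta> \<sigma> \<inter> ambiguous_L \<delta> \<zeta> \<sigma> = pos_units_L \<delta>"

text \<open>
  The canonical divisors of \<open>d\<close> with respect to \<open>n\<close> are \<open>d\<^sub>1, d\<^sub>2, d\<^sub>3\<close>, the cases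
  \<open>i = 1, 2, 0\<close> (note the last one) of the following product.
\<close>

definition canonical_divisor :: "int \<Rightarrow> int \<Rightarrow> nat \<Rightarrow> int" where
  "canonical_divisor d n i = \<Prod>{l \<in> prime_factors d. multiplicity l n = i}"

end

theory Submission
  imports Defs "Jordan_Normal_Form.Char_Poly"
begin

text \<open>
  If \<open>\<beta>\<close> generates an ambiguous ideal, then \<open>\<beta>\<^sup>3 / N(\<beta>)\<close> is a unit. The positive units of \<open>L\<close> form a
  cyclic group, so modulo cubes there are at most three units; since a cube root of a rational in \<open>L\<close>
  is a rational multiple of a power of \<open>\<delta>\<close>, it follows that every positive ambiguous \<open>\<beta>\<close> is
  \<open>r \<delta>\<^sup>j \<alpha>\<^sup>i \<eta>\<close> with \<open>r\<close> rational, \<open>\<eta>\<close> a positive unit and \<open>i < 3\<close>. A lattice minimum is primitive, and the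
  inequalities on the \<open>d\<^sub>i\<close> make the elements of smallest norm in the classes \<open>i = 0, 1, 2\<close>
  (up to units \<open>1\<close>, \<open>\<alpha>\<close>, and \<open>\<alpha>\<^sup>2/d\<^sub>2\<close> resp. \<open>\<alpha>\<^sup>2\<delta>/(d\<^sub>1 d\<^sub>2)\<close>) smaller than the others, both in value and in
  the conjugates. Finally \<open>\<gamma> = \<alpha>\<close>, and likewise the representative of the class \<open>i = 2\<close>, is beaten by
  \<open>\<gamma> (1 + s p + t q) / 3\<close> with \<open>p = \<delta>/d\<^sub>2\<close>, \<open>q = \<delta>\<^sup>2/(d\<^sub>1 d\<^sub>2)\<close> and suitable signs \<open>s, t\<close>, which is integral
  because \<open>d \<equiv> \<plusminus>1\<close> modulo 9.
\<close>

section \<open>Algebraic integers form a ring\<close>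

text \<open>The numbers \<gamma>, \<gamma> p, \<gamma> q are the primitive generators reached from
  \<gamma> by powers of \<delta>, and the competitor is their average with signs. Its conjugate has
  squared modulus |\<gamma>'|^2 (1 + p^2 + q^2 - s p - t q - s t p q) / 9. Since p, q > 1, the signs
  s = t = 1 give an average above \<gamma>; they would belong to e1, e2, e3 all congruent modulo 3.
  The three congruence conditions of the theorem are the other sign patterns. Ideal arithmetic is
  avoided: an equation \<gamma>^3 = e1 e2^2 \<epsilon> with a positive unit \<epsilon> survives
  multiplication by \<delta> and squaring (up to rational factors), and it yields integrality and
  the norm of \<gamma>. No existence theorem for units enters: only that the positive units are
  cyclic, possibly trivial, and that \<alpha> itself supplies a unit that is not a cube. The
  quotient of the two candidates for the class i = 2 is \<delta>/d1, whose cube is d2 d3 / d1^2.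
  Hence the split into d1^2 < d2 d3 and d2 d3 < d1^2.\<close>

definition int_span :: "'a::comm_ring_1 set \<Rightarrow> 'a set" where
  "int_span S = {\<Sum>s\<in>S. of_int (c s) * s | c. True}"

lemma int_span_base:
  assumes "finite S" "s \<in> S"
  shows "s \<in> int_span S"
proof -
  have "s = (\<Sum>t\<in>S. of_int (if t = s then 1 else 0) * t)"
    using assms by (simp add: if_distrib[where f = of_int] if_distrib[where f = "\<lambda>u. u * _"] cong: if_cong)
  then show ?thesis
    unfolding int_span_def by (intro CollectI exI[of _ "\<lambda>t. if t = s then 1 else 0"]) simp
qed

lemma int_span_zero: "0 \<in> int_span S"
  unfolding int_span_def by (rule CollectI, rule exI[of _ "\<lambda>_. 0"]) simp

lemma int_span_add:
  assumes "x \<in> int_span S" "y \<in> int_span S"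
  shows "x + y \<in> int_span S"
proof -
  obtain a b where "x = (\<Sum>s\<in>S. of_int (a s) * s)" "y = (\<Sum>s\<in>S. of_int (b s) * s)"
    using assms unfolding int_span_def by blast
  then have "x + y = (\<Sum>s\<in>S. of_int (a s + b s) * s)"
    by (simp add: sum.distrib algebra_simps)
  then show ?thesis
    unfolding int_span_def by (intro CollectI exI[of _ "\<lambda>s. a s + b s"]) simp
qed

lemma int_span_scale:
  assumes "x \<in> int_span S"
  shows "of_int k * x \<in> int_span S"
proof -
  obtain a where "x = (\<Sum>s\<in>S. of_int (a s) * s)"
    using assms unfolding int_span_def by blast
  then have "of_int k * x = (\<Sum>s\<in>S. of_int (k * a s) * s)"
    by (simp add: sum_distrib_left algebra_simps)
  then show ?thesis
    unfolding int_span_def by (intro CollectI exI[of _ "\<lambda>s. k * a s"]) simp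
qed

lemma int_span_sum:
  assumes "\<And>i. i \<in> I \<Longrightarrow> f i \<in> int_span S"
  shows "(\<Sum>i\<in>I. of_int (c i) * f i) \<in> int_span S"
  using assms
  by (induction I rule: infinite_finite_induct) (auto intro: int_span_zero int_span_add int_span_scale)

lemma int_span_mult:
  assumes "\<And>s. s \<in> S \<Longrightarrow> z * s \<in> int_span S" and "x \<in> int_span S"
  shows "z * x \<in> int_span S"
proof -
  obtain a where a: "x = (\<Sum>s\<in>S. of_int (a s) * s)"
    using assms unfolding int_span_def by blast
  have "z * x = (\<Sum>s\<in>S. of_int (a s) * (z * s))"
    unfolding a by (simp add: sum_distrib_left algebra_simps)
  then show ?thesis
    using int_span_sum[of S "\<lambda>s. z * s"] assms by simp
qed

text \<open>The determinant trick: \<open>z\<close> is an eigenvalue of an integer matrix.\<close>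

lemma algebraic_int_if_stable:
  fixes z :: "'a::field_char_0"
  assumes "finite S" "s0 \<in> S" "s0 \<noteq> 0"
    and "\<And>s. s \<in> S \<Longrightarrow> z * s \<in> int_span S"
  shows "algebraic_int z"
proof -
  obtain c where c: "z * s = (\<Sum>t\<in>S. of_int (c s t) * t)" if "s \<in> S" for s
    using assms(4) unfolding int_span_def mem_Collect_eq by metis
  obtain b where b: "bij_betw b {0..<card S} S"
    using ex_bij_betw_nat_finite[OF assms(1)] by blast
  define n where "n = card S"
  define A :: "int mat" where "A = mat n n (\<lambda>(i, j). c (b i) (b j))"
  define B :: "'a mat" where "B = map_mat of_int A"
  define v where "v = vec n b"
  have A: "A \<in> carrier_mat n n" and B: "B \<in> carrier_mat n n"
    by (simp_all add: A_def B_def)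
  have "B *\<^sub>v v = smult_vec z v"
  proof (rule eq_vecI)
    fix i assume "i < dim_vec (smult_vec z v)"
    then have i: "i < n" by (simp add: v_def)
    then have bi: "b i \<in> S" using b by (auto simp: n_def bij_betw_def)
    have "vec_index (B *\<^sub>v v) i = (\<Sum>j = 0..<n. of_int (c (b i) (b j)) * b j)"
      using i by (auto simp: B_def A_def v_def scalar_prod_def intro!: sum.cong)
    also have "\<dots> = (\<Sum>t\<in>S. of_int (c (b i) t) * t)"
      using sum.reindex_bij_betw[OF b, of "\<lambda>t. of_int (c (b i) t) * t"] by (simp add: n_def)
    also have "\<dots> = vec_index (smult_vec z v) i"
      using c[OF bi] i by (simp add: v_def)
    finally show "vec_index (B *\<^sub>v v) i = vec_index (smult_vec z v) i" .
  qed (simp add: B_def A_def v_def)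
  moreover have "v \<noteq> 0\<^sub>v n"
  proof -
    obtain i where "i < n" "b i = s0"
      using b assms(2) unfolding n_def bij_betw_def by (metis atLeastLessThan_iff imageE)
    then have "vec_index v i \<noteq> vec_index (0\<^sub>v n) i" using assms(3) by (simp add: v_def)
    then show ?thesis by metis
  qed
  ultimately have "eigenvector B v z"
    using B by (simp add: eigenvector_def v_def)
  then have "poly (char_poly B) z = 0"
    using eigenvalue_root_char_poly[OF B] by (auto simp: eigenvalue_def)
  moreover have "char_poly B = map_poly of_int (char_poly A)"
    unfolding B_def by (rule of_int_hom.char_poly_hom[OF A])
  moreover have "lead_coeff (char_poly A) = 1"
    using degree_monic_char_poly[OF A] by auto
  ultimately have "poly (map_poly of_int (char_poly A)) z = 0 \<and> lead_coeff (char_poly A) = 1"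
    by simp
  then show ?thesis
    unfolding algebraic_int_altdef_ipoly by (rule exI)
qed

text \<open>The monic relation is solved for its top power. A monic constant has no root, so
  \<open>m\<close> is positive and 1 is among the powers below \<open>m\<close>.\<close>

lemma algebraic_int_power_reduce:
  fixes x :: "'a::field_char_0"
  assumes "algebraic_int x"
  obtains m c where "0 < m" "x ^ m = (\<Sum>i<m. of_int (c i) * x ^ i)"
proof -
  obtain p where p: "poly (map_poly of_int p) x = 0" "lead_coeff p = 1"
    using assms by (auto simp: algebraic_int_altdef_ipoly)
  have "degree p \<noteq> 0"
  proof
    assume "degree p = 0"
    then obtain a where "p = [:a:]" by (rule degree_eq_zeroE)
    then show False using p by simp
  qed
  have deg: "degree (map_poly of_int p :: 'a poly) = degree p"
    by (rule Polynomial.degree_map_poly) simp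
  have "0 = poly (map_poly of_int p) x"
    using p(1) by simp
  also have "\<dots> = (\<Sum>i\<le>degree p. of_int (coeff p i) * x ^ i)"
    unfolding poly_altdef deg by (intro sum.cong refl) (simp only: coeff_map_poly of_int_0)
  also have "(\<Sum>i\<le>degree p. of_int (coeff p i) * x ^ i) = (\<Sum>i<degree p. of_int (coeff p i) * x ^ i) + x ^ degree p"
    unfolding lessThan_Suc_atMost[symmetric] sum.lessThan_Suc using p(2) by simp
  finally have "x ^ degree p = (\<Sum>i<degree p. of_int (- coeff p i) * x ^ i)"
    by (simp add: sum_negf eq_neg_iff_add_eq_0 add.commute[of "x ^ degree p"])
  then show thesis using \<open>degree p \<noteq> 0\<close> that[of "degree p" "\<lambda>i. - coeff p i"] by simp
qed

text \<open>The monomials \<open>x ^ i * y ^ j\<close> below the two degrees span a group stable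
  under x and under y, hence under their sum and product.\<close>

lemma algebraic_int_add_mult:
  fixes x y :: "'a::field_char_0"
  assumes "algebraic_int x" "algebraic_int y"
  shows algebraic_int_add: "algebraic_int (x + y)"
    and algebraic_int_mult: "algebraic_int (x * y)"
proof -
  obtain m c where m: "0 < m" "x ^ m = (\<Sum>i<m. of_int (c i) * x ^ i)"
    using assms(1) by (rule algebraic_int_power_reduce)
  obtain n e where n: "0 < n" "y ^ n = (\<Sum>i<n. of_int (e i) * y ^ i)"
    using assms(2) by (rule algebraic_int_power_reduce)
  define S where "S = (\<lambda>(i, j). x ^ i * y ^ j) ` ({..<m} \<times> {..<n})"
  have fin: "finite S" by (simp add: S_def)
  have S: "x ^ i * y ^ j \<in> int_span S" if "i < m" "j < n" for i j
    using that by (intro int_span_base[OF fin]) (auto simp: S_def)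
  have one: "1 \<in> S" using m(1) n(1) by (force simp: S_def)
  have X: "x * s \<in> int_span S" if s: "s \<in> S" for s
  proof -
    obtain i j where ij: "i < m" "j < n" "s = x ^ i * y ^ j" using s by (auto simp: S_def)
    show ?thesis
    proof (cases "Suc i < m")
      case True
      then show ?thesis using S[of "Suc i" j] ij by (simp add: mult.assoc)
    next
      case False
      then have "x * x ^ i = x ^ m" using ij(1) by (metis Suc_lessI power_Suc)
      then have "x * s = (\<Sum>k<m. of_int (c k) * (x ^ k * y ^ j))"
        unfolding ij(3) mult.assoc[symmetric] m(2) by (simp add: sum_distrib_right)
      then show ?thesis using int_span_sum[of "{..<m}" "\<lambda>k. x ^ k * y ^ j"] S ij(2) by simp
    qed
  qed
  have Y: "y * s \<in> int_span S" if s: "s \<in> S" for s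
  proof -
    obtain i j where ij: "i < m" "j < n" "s = x ^ i * y ^ j" using s by (auto simp: S_def)
    show ?thesis
    proof (cases "Suc j < n")
      case True
      then show ?thesis using S[of i "Suc j"] ij by (simp add: ac_simps)
    next
      case False
      then have y: "y * y ^ j = y ^ n" using ij(2) by (metis Suc_lessI power_Suc)
      have "y * s = x ^ i * (y * y ^ j)" unfolding ij(3) by (simp add: ac_simps)
      also have "\<dots> = (\<Sum>k<n. of_int (e k) * (x ^ i * y ^ k))"
        unfolding y n(2) by (simp add: sum_distrib_left ac_simps)
      finally show ?thesis using int_span_sum[of "{..<n}" "\<lambda>k. x ^ i * y ^ k"] S ij(1) by simp
    qed
  qed
  show "algebraic_int (x + y)"
  proof (rule algebraic_int_if_stable[OF fin one])
    show "(x + y) * s \<in> int_span S" if s: "s \<in> S" for s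
      using int_span_add[OF X[OF s] Y[OF s]] by (simp add: distrib_right)
  qed simp
  show "algebraic_int (x * y)"
  proof (rule algebraic_int_if_stable[OF fin one])
    show "(x * y) * s \<in> int_span S" if s: "s \<in> S" for s
      using int_span_mult[OF X Y[OF s]] by (simp add: mult.assoc)
  qed simp
qed

lemma algebraic_int_power:
  fixes x :: "'a::field_char_0"
  shows "algebraic_int x \<Longrightarrow> algebraic_int (x ^ n)"
  by (induction n) (simp_all add: algebraic_int_mult)

section \<open>The field \<open>L\<close> and its conjugates\<close>

lemma rta_sel [simp]:
  "carrier ring_of_type_algebra = UNIV" "x \<otimes>\<^bsub>ring_of_type_algebra\<^esub> y = x * y"
  "x \<oplus>\<^bsub>ring_of_type_algebra\<^esub> y = x + y" "\<one>\<^bsub>ring_of_type_algebra\<^esub> = 1" "\<zero>\<^bsub>ring_of_type_algebra\<^esub> = 0"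
  by (simp_all add: ring_of_type_algebra_def)

lemma rta_a_inv [simp]: "\<ominus>\<^bsub>ring_of_type_algebra\<^esub> x = - (x :: 'a::field)"
  unfolding a_inv_def m_inv_def
  by (rule the_equality) (simp_all add: ring_of_type_algebra_def eq_neg_iff_add_eq_0 add.commute)

lemma rta_m_inv [simp]: "x \<noteq> 0 \<Longrightarrow> inv\<^bsub>ring_of_type_algebra\<^esub> x = inverse (x :: 'a::field)"
  unfolding m_inv_def
  by (rule the_equality) (simp add: ring_of_type_algebra_def, simp add: ring_of_type_algebra_def, metis inverse_unique)

context
  fixes H G :: "'a::field_char_0 set"
  defines "G \<equiv> generate_field ring_of_type_algebra H"
begin

lemma gf_one: "1 \<in> G"
  using generate_field.one[of ring_of_type_algebra H] by (simp add: G_def)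

lemma gf_incl: "x \<in> H \<Longrightarrow> x \<in> G"
  using generate_field.incl[of x H ring_of_type_algebra] by (simp add: G_def)

lemma gf_add: "x \<in> G \<Longrightarrow> y \<in> G \<Longrightarrow> x + y \<in> G"
  using generate_field.eng_add[of x ring_of_type_algebra H y] by (simp add: G_def)

lemma gf_mult: "x \<in> G \<Longrightarrow> y \<in> G \<Longrightarrow> x * y \<in> G"
  using generate_field.eng_mult[of x ring_of_type_algebra H y] by (simp add: G_def)

lemma gf_minus: "x \<in> G \<Longrightarrow> - x \<in> G"
  using generate_field.a_inv[of x ring_of_type_algebra H] by (simp add: G_def)

lemma gf_zero: "0 \<in> G"
  using gf_add[OF gf_one gf_minus[OF gf_one]] by simp

lemma gf_inverse: "x \<in> G \<Longrightarrow> inverse x \<in> G"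
  using generate_field.m_inv[of x ring_of_type_algebra H] gf_zero
  by (cases "x = 0") (simp_all add: G_def)

lemma gf_diff: "x \<in> G \<Longrightarrow> y \<in> G \<Longrightarrow> x - y \<in> G"
  using gf_add[of x "- y"] gf_minus[of y] by simp

lemma gf_divide: "x \<in> G \<Longrightarrow> y \<in> G \<Longrightarrow> x / y \<in> G"
  using gf_mult[of x "inverse y"] gf_inverse[of y] by (simp add: divide_inverse)

lemma gf_power: "x \<in> G \<Longrightarrow> x ^ n \<in> G"
  by (induction n) (simp_all add: gf_one gf_mult)

lemma gf_of_int: "of_int k \<in> G"
proof -
  have "of_nat n \<in> G" for n
    by (induction n) (simp_all add: gf_zero gf_one gf_add)
  then show ?thesis
    by (cases k rule: int_cases2) (simp_all add: gf_minus)
qed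

lemma gf_Rats: "x \<in> \<rat> \<Longrightarrow> x \<in> G"
  by (erule Rats_cases') (simp add: gf_divide gf_of_int)

lemmas gf_closed = gf_one gf_zero gf_add gf_mult gf_minus gf_inverse gf_diff gf_divide gf_power gf_of_int gf_Rats

lemma gf_minimal:
  assumes "H \<subseteq> E" "1 \<in> E" "\<And>x y. x \<in> E \<Longrightarrow> y \<in> E \<Longrightarrow> x + y \<in> E" "\<And>x y. x \<in> E \<Longrightarrow> y \<in> E \<Longrightarrow> x * y \<in> E"
    "\<And>x. x \<in> E \<Longrightarrow> - x \<in> E" "\<And>x. x \<in> E \<Longrightarrow> x \<noteq> 0 \<Longrightarrow> inverse x \<in> E"
  shows "G \<subseteq> E"
proof
  fix x assume "x \<in> G"
  then show "x \<in> E"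
    unfolding G_def
  proof (induction rule: generate_field.induct)
    case (m_inv h)
    then show ?case using assms(6)[of h] by (metis rta_m_inv rta_sel(5))
  qed (use assms(1-5) in \<open>simp_all add: subset_iff\<close>)
qed

end

section \<open>The pure cubic field, the cube root of unity and the automorphism\<close>

locale pure_cubic =
  fixes d :: int and \<delta> :: real and \<zeta> :: complex and \<sigma> :: "complex \<Rightarrow> complex"
  assumes d_gt: "d > 1" and sqf: "squarefree d" and delta: "\<delta> = root 3 (real_of_int d)"
    and prim: "primitive_cube_root \<zeta>" and sigma: "is_sigma \<delta> \<zeta> \<sigma>"
begin

abbreviation "L \<equiv> field_L \<delta>"
abbreviation "K \<equiv> field_k \<delta> \<zeta>"
abbreviation "cj \<equiv> conj1 \<sigma>"

lemma delta3: "\<delta> ^ 3 = real_of_int d"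
  using d_gt unfolding delta by (simp add: odd_real_root_pow)

lemma delta_gt: "\<delta> > 1"
  using d_gt unfolding delta by simp

lemma delta_alg_int: "algebraic_int \<delta>"
  unfolding delta by (intro algebraic_int_nth_root_real algebraic_int_of_int)

lemma delta_irrational: "\<delta> \<notin> \<rat>"
proof
  assume "\<delta> \<in> \<rat>"
  then obtain m where m: "\<delta> = of_int m"
    using rational_algebraic_int_is_int[OF delta_alg_int] by (auto elim: Ints_cases)
  have dm: "d = m ^ 3"
    using delta3 unfolding m by (metis of_int_eq_iff of_int_power)
  then have "m ^ 2 dvd d" by (simp add: le_imp_power_dvd)
  then have "is_unit m" using sqf by (simp add: squarefree_def)
  then have "m = 1 \<or> m = -1" by (simp add: abs_if split: if_splits)
  then have "d = 1 \<or> d = -1" using dm by auto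
  then show False using d_gt by simp
qed

lemma zeta_quad: "\<zeta> ^ 2 = - 1 - \<zeta>"
proof -
  have "(\<zeta> - 1) * (\<zeta> ^ 2 + \<zeta> + 1) = \<zeta> ^ 3 - 1" by (simp add: algebra_simps power2_eq_square power3_eq_cube)
  then have "\<zeta> ^ 2 + \<zeta> + 1 = 0" using prim by (simp add: primitive_cube_root_def)
  then show ?thesis by (simp add: eq_neg_iff_add_eq_0 algebra_simps)
qed

lemma zeta3: "\<zeta> ^ 3 = 1"
  using prim by (simp add: primitive_cube_root_def)

lemma zeta_cnj: "cnj \<zeta> = \<zeta> ^ 2"
proof -
  have "norm \<zeta> ^ 3 = 1" using zeta3 norm_power[of \<zeta> 3] by simp
  then have "norm \<zeta> = 1" using power_eq_imp_eq_base[of "norm \<zeta>" 3 1] by simp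
  then have "\<zeta> * cnj \<zeta> = 1" using complex_norm_square[of \<zeta>] by simp
  then have "\<zeta> ^ 3 * cnj \<zeta> = \<zeta> ^ 2" by (simp add: power3_eq_cube power2_eq_square mult.assoc)
  then show ?thesis by (simp add: zeta3)
qed

lemma zeta_Re_Im: "Re \<zeta> = - 1 / 2" "(Im \<zeta>) ^ 2 = 3 / 4"
proof -
  have *: "cnj \<zeta> = - 1 - \<zeta>" using zeta_cnj zeta_quad by simp
  have "Re (cnj \<zeta>) = Re (- 1 - \<zeta>)" using * by simp
  then show r: "Re \<zeta> = - 1 / 2" by simp
  have "Re (\<zeta> ^ 2) = Re (- 1 - \<zeta>)" using zeta_quad by simp
  then have "(Re \<zeta>) ^ 2 - (Im \<zeta>) ^ 2 = - 1 - Re \<zeta>" by (simp add: power2_eq_square)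
  then show "(Im \<zeta>) ^ 2 = 3 / 4" using r by (simp add: power2_eq_square)
qed

text \<open>As \<zeta> is not real, 1 + \<zeta> + \<zeta>^2 = 0 is the only real relation up to
  scaling. It permits comparing coordinates of a number and its conjugate.\<close>

lemma zeta_relation:
  fixes x y z :: real
  assumes "of_real x + of_real y * \<zeta> + of_real z * \<zeta> ^ 2 = 0"
  shows "x = y \<and> y = z"
proof -
  have *: "of_real (x - z) + of_real (y - z) * \<zeta> = 0"
    using assms unfolding zeta_quad by (simp add: algebra_simps)
  then have "Im (of_real (x - z) + of_real (y - z) * \<zeta>) = 0" by simp
  then have "(y - z) * Im \<zeta> = 0" by simp
  moreover have "Im \<zeta> \<noteq> 0" using zeta_Re_Im(2) by auto
  ultimately have "y = z" by simp
  then show ?thesis using * by auto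
qed

lemma L_delta: "\<delta> \<in> L"
  unfolding field_L_def by (rule gf_incl) simp

lemmas L_closed = gf_closed[where H = "{\<delta>}", folded field_L_def]
lemmas K_closed = gf_closed[where H = "complex_of_real ` L \<union> {\<zeta>}", folded field_k_def]

lemma L_sub_K: "x \<in> L \<Longrightarrow> complex_of_real x \<in> K"
  unfolding field_k_def by (rule gf_incl) simp

lemma zeta_K: "\<zeta> \<in> K"
  unfolding field_k_def by (rule gf_incl) simp

lemma k0_Rats: "x \<in> \<rat> \<Longrightarrow> x \<in> field_k0 \<zeta>"
  unfolding field_k0_def by (rule gf_Rats)

lemma k0_zeta: "\<zeta> \<in> field_k0 \<zeta>"
  unfolding field_k0_def by (rule gf_incl) simp

lemma sigma_K: "x \<in> K \<Longrightarrow> \<sigma> x \<in> K"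
  and sigma_add: "x \<in> K \<Longrightarrow> y \<in> K \<Longrightarrow> \<sigma> (x + y) = \<sigma> x + \<sigma> y"
  and sigma_mult: "x \<in> K \<Longrightarrow> y \<in> K \<Longrightarrow> \<sigma> (x * y) = \<sigma> x * \<sigma> y"
  and sigma_bij: "bij_betw \<sigma> K K"
  using sigma ring_iso_memE[of \<sigma> "ring_of_type_algebra\<lparr>carrier := K\<rparr>" "ring_of_type_algebra\<lparr>carrier := K\<rparr>"]
  by (simp_all add: is_sigma_def)

lemma sigma_Rats: "x \<in> \<rat> \<Longrightarrow> \<sigma> x = x"
  using sigma k0_Rats by (simp add: is_sigma_def)

lemma sigma_zeta: "\<sigma> \<zeta> = \<zeta>"
  using sigma k0_zeta by (simp add: is_sigma_def)

lemma sigma_delta: "\<sigma> (of_real \<delta>) = \<zeta> * of_real \<delta>"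
  using sigma by (simp add: is_sigma_def)

lemma sigma_eq_0_iff: "x \<in> K \<Longrightarrow> \<sigma> x = 0 \<longleftrightarrow> x = 0"
  using sigma_bij sigma_Rats[of 0] K_closed(2) by (metis Rats_0 bij_betw_imp_inj_on inj_on_def)

lemma sigma_poly:
  assumes "x \<in> K"
  shows "poly (map_poly of_int p) x \<in> K \<and> \<sigma> (poly (map_poly of_int p) x) = poly (map_poly of_int p) (\<sigma> x)"
proof (induction p)
  case 0
  then show ?case using K_closed(2) sigma_Rats[of 0] by simp
next
  case (pCons a p)
  then show ?case
    using assms sigma_Rats[of "of_int a"] by (simp add: map_poly_pCons K_closed sigma_add sigma_mult)
qed

text \<open>Integer polynomials commute with \<open>\<sigma>\<close>, and \<open>\<sigma>\<close>
  sends only 0 to 0, so x and its image are roots of the same integer polynomials.\<close>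

lemma sigma_algebraic_int_iff:
  assumes "x \<in> K"
  shows "algebraic_int (\<sigma> x) \<longleftrightarrow> algebraic_int x"
  using sigma_poly[OF assms] sigma_eq_0_iff unfolding algebraic_int_altdef_ipoly by metis

lemma sigma_int_k: "\<sigma> ` int_k \<delta> \<zeta> = int_k \<delta> \<zeta>"
proof
  show "\<sigma> ` int_k \<delta> \<zeta> \<subseteq> int_k \<delta> \<zeta>"
    by (auto simp: int_k_def sigma_K sigma_algebraic_int_iff)
  show "int_k \<delta> \<zeta> \<subseteq> \<sigma> ` int_k \<delta> \<zeta>"
  proof
    fix y assume y: "y \<in> int_k \<delta> \<zeta>"
    then obtain x where "x \<in> K" "y = \<sigma> x"
      using sigma_bij by (auto simp: int_k_def bij_betw_def)
    then show "y \<in> \<sigma> ` int_k \<delta> \<zeta>"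
      using y by (auto simp: int_k_def sigma_algebraic_int_iff)
  qed
qed

lemma cj_add: "x \<in> L \<Longrightarrow> y \<in> L \<Longrightarrow> cj (x + y) = cj x + cj y"
  by (simp add: conj1_def sigma_add L_sub_K)

lemma cj_mult: "x \<in> L \<Longrightarrow> y \<in> L \<Longrightarrow> cj (x * y) = cj x * cj y"
  by (simp add: conj1_def sigma_mult L_sub_K)

lemma of_real_Rats: "x \<in> \<rat> \<Longrightarrow> complex_of_real x \<in> \<rat>"
  by (auto elim!: Rats_cases)

lemma cj_Rats: "x \<in> \<rat> \<Longrightarrow> cj x = of_real x"
  using sigma_Rats[OF of_real_Rats] by (simp add: conj1_def)

lemma cj_delta: "cj \<delta> = \<zeta> * of_real \<delta>"
  by (simp add: conj1_def sigma_delta)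

lemma cj_power: "x \<in> L \<Longrightarrow> cj (x ^ n) = cj x ^ n"
  by (induction n) (simp_all add: cj_mult L_closed cj_Rats)

lemma cj_eq_0_iff: "x \<in> L \<Longrightarrow> cj x = 0 \<longleftrightarrow> x = 0"
  using sigma_eq_0_iff[OF L_sub_K] by (simp add: conj1_def)

section \<open>Coordinates with respect to 1, \<delta>, \<delta>^2\<close>

definition span3 :: "real \<Rightarrow> real \<Rightarrow> real \<Rightarrow> real" where
  "span3 a b c = a + b * \<delta> + c * \<delta> ^ 2"

lemma span3_mult:
  fixes a b c a' b' c' :: real
  shows "span3 a b c * span3 a' b' c' =
   span3 (a * a' + d * (b * c' + c * b')) (a * b' + b * a' + d * c * c') (a * c' + b * b' + c * a')"
  unfolding span3_def delta3[symmetric] by (simp add: algebra_simps power2_eq_square power3_eq_cube)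

text \<open>The cofactor is the product of the two complex conjugates of the first factor (see
  \<open>cmod_cj_sq\<close>), so the right-hand side is the norm in coordinates.\<close>

lemma span3_norm:
  fixes a b c :: real
  shows "span3 a b c * span3 (a\<^sup>2 - d * b * c) (d * c\<^sup>2 - a * b) (b\<^sup>2 - a * c) = a ^ 3 + d * b ^ 3 + d\<^sup>2 * c ^ 3 - 3 * d * a * b * c"
  unfolding span3_mult by (simp add: span3_def algebra_simps power2_eq_square power3_eq_cube)

text \<open>The right-hand side is the shape of |u + v \<zeta> + w \<zeta>^2|^2 for real u, v, w. As
  a sum of squares it shows when the cofactor vanishes.\<close>

lemma span3_norm_cofactor:
  fixes a b c :: real
  shows "span3 (a\<^sup>2 - d * b * c) (d * c\<^sup>2 - a * b) (b\<^sup>2 - a * c) =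
     ((a - b * \<delta>)\<^sup>2 + (b * \<delta> - c * \<delta>\<^sup>2)\<^sup>2 + (a - c * \<delta>\<^sup>2)\<^sup>2) / 2"
  unfolding span3_def delta3[symmetric] by (simp add: field_simps power2_eq_square power3_eq_cube)

lemma span3_eq_0:
  fixes a b c :: real
  assumes "a \<in> \<rat>" "b \<in> \<rat>" "span3 (a\<^sup>2 - d * b * c) (d * c\<^sup>2 - a * b) (b\<^sup>2 - a * c) = 0"
  shows "a = 0 \<and> b = 0 \<and> c = 0"
proof -
  have ab: "a = b * \<delta>" and bc: "b * \<delta> = c * \<delta>\<^sup>2"
    using assms(3) unfolding span3_norm_cofactor by (auto simp: add_nonneg_eq_0_iff)
  have "b = 0"
  proof (rule ccontr)
    assume "b \<noteq> 0"
    then have "\<delta> = a / b" using ab by simp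
    then show False using delta_irrational assms(1,2) by simp
  qed
  then show ?thesis using ab bc delta_gt by simp
qed

lemma L_iff: "x \<in> L \<longleftrightarrow> (\<exists>a\<in>\<rat>. \<exists>b\<in>\<rat>. \<exists>c\<in>\<rat>. x = span3 a b c)"
proof -
  define E where "E = {span3 a b c |a b c. a \<in> \<rat> \<and> b \<in> \<rat> \<and> c \<in> \<rat>}"
  have EI: "span3 a b c \<in> E" if "a \<in> \<rat>" "b \<in> \<rat>" "c \<in> \<rat>" for a b c
    using that unfolding E_def by blast
  have "L \<subseteq> E"
    unfolding field_L_def
  proof (rule gf_minimal)
    show "{\<delta>} \<subseteq> E" using EI[of 0 1 0] by (simp add: span3_def)
    show "1 \<in> E" using EI[of 1 0 0] by (simp add: span3_def)
    show "x + y \<in> E" if xy: "x \<in> E" "y \<in> E" for x y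
    proof -
      obtain a b c a' b' c' where *: "x = span3 a b c" "y = span3 a' b' c'"
        "a \<in> \<rat>" "b \<in> \<rat>" "c \<in> \<rat>" "a' \<in> \<rat>" "b' \<in> \<rat>" "c' \<in> \<rat>"
        using xy unfolding E_def by blast
      then have "x + y = span3 (a + a') (b + b') (c + c')" by (simp add: span3_def algebra_simps)
      then show ?thesis using * by (simp add: EI)
    qed
    show "x * y \<in> E" if xy: "x \<in> E" "y \<in> E" for x y
    proof -
      obtain a b c a' b' c' where *: "x = span3 a b c" "y = span3 a' b' c'"
        "a \<in> \<rat>" "b \<in> \<rat>" "c \<in> \<rat>" "a' \<in> \<rat>" "b' \<in> \<rat>" "c' \<in> \<rat>"
        using xy unfolding E_def by blast
      then show ?thesis unfolding *(1,2) span3_mult by (intro EI) auto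
    qed
    show "- x \<in> E" if x: "x \<in> E" for x
    proof -
      obtain a b c where *: "x = span3 a b c" "a \<in> \<rat>" "b \<in> \<rat>" "c \<in> \<rat>" using x unfolding E_def by blast
      then have "- x = span3 (- a) (- b) (- c)" by (simp add: span3_def)
      then show ?thesis using * by (simp add: EI)
    qed
    show "inverse x \<in> E" if x: "x \<in> E" "x \<noteq> 0" for x
    proof -
      obtain a b c where *: "x = span3 a b c" "a \<in> \<rat>" "b \<in> \<rat>" "c \<in> \<rat>" using x unfolding E_def by blast
      define N where "N = a ^ 3 + d * b ^ 3 + d\<^sup>2 * c ^ 3 - 3 * d * a * b * c"
      define y where "y = span3 (a\<^sup>2 - d * b * c) (d * c\<^sup>2 - a * b) (b\<^sup>2 - a * c)"
      \<comment> \<open>A nonzero cofactor makes \<open>N = x * y\<close> nonzero too, so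
        independence of 1, \<delta>, \<delta>^2 needs no separate argument.\<close>
      have "y \<noteq> 0"
        using span3_eq_0[of a b c] *(2,3) x(2) by (auto simp: y_def *(1) span3_def)
      moreover have "x * y = N" using span3_norm by (simp add: *(1) y_def N_def)
      ultimately have "inverse x = y / N"
        using x(2) by (auto simp: field_simps)
      also have "\<dots> = span3 ((a\<^sup>2 - d * b * c) / N) ((d * c\<^sup>2 - a * b) / N) ((b\<^sup>2 - a * c) / N)"
        by (simp add: y_def span3_def add_divide_distrib)
      finally show ?thesis
        using *(2-4) by (simp add: EI N_def)
    qed
  qed
  moreover have "span3 a b c \<in> L" if "a \<in> \<rat>" "b \<in> \<rat>" "c \<in> \<rat>" for a b c
    unfolding span3_def using that L_delta by (simp add: L_closed(3,4,9,11))
  ultimately show ?thesis unfolding E_def by blast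
qed

lemma cj_span3:
  fixes a b c :: real
  assumes "a \<in> \<rat>" "b \<in> \<rat>" "c \<in> \<rat>"
  shows "cj (span3 a b c) = of_real a + of_real (b * \<delta>) * \<zeta> + of_real (c * \<delta>\<^sup>2) * \<zeta>\<^sup>2"
  using assms unfolding span3_def
  by (simp add: cj_add cj_mult cj_power cj_Rats cj_delta L_closed L_delta algebra_simps power_mult_distrib)

text \<open>Applying \<open>\<sigma>\<close> twice sends \<delta> to \<zeta>^2 \<delta>, and
  \<zeta>^2 is the complex conjugate of \<zeta>. From here on only the modulus of
  \<open>cj x\<close> matters.\<close>

lemma cnj_cj:
  assumes "x \<in> L"
  shows "conj2 \<sigma> x = cnj (cj x)"
proof -
  obtain a b c where *: "a \<in> \<rat>" "b \<in> \<rat>" "c \<in> \<rat>" "x = span3 a b c"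
    using assms L_iff by blast
  have K: "of_real (a::real) \<in> K" if "a \<in> \<rat>" for a
    using that by (intro L_sub_K L_closed)
  have "conj2 \<sigma> x = \<sigma> (of_real a + of_real b * (\<zeta> * of_real \<delta>) + of_real c * (\<zeta> * of_real \<delta>)\<^sup>2)"
    using cj_span3[OF *(1-3)] unfolding *(4)
    by (simp add: conj1_def conj2_def algebra_simps power_mult_distrib)
  also have "\<dots> = of_real a + of_real b * (\<zeta> * (\<zeta> * of_real \<delta>)) + of_real c * (\<zeta> * (\<zeta> * of_real \<delta>))\<^sup>2"
    using * sigma_Rats[OF of_real_Rats]
    by (simp add: power2_eq_square sigma_add sigma_mult sigma_zeta sigma_delta zeta_K K L_sub_K L_delta K_closed)
  also have "\<dots> = of_real a + of_real (b * \<delta>) * \<zeta>\<^sup>2 + of_real (c * \<delta>\<^sup>2) * (\<zeta>\<^sup>2)\<^sup>2"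
    by (simp add: power2_eq_square algebra_simps)
  also have "\<dots> = cnj (cj x)"
    unfolding *(4) cj_span3[OF *(1-3)] by (simp add: zeta_cnj)
  finally show ?thesis .
qed

section \<open>The norm as a real number, and the ring of integers of L\<close>

definition nrm :: "real \<Rightarrow> real" where
  "nrm x = x * (cmod (cj x))\<^sup>2"

lemma cmod_sq_conj: "x \<in> L \<Longrightarrow> cj x * conj2 \<sigma> x = of_real ((cmod (cj x))\<^sup>2)"
  by (simp only: cnj_cj complex_norm_square)

lemma norm_L_nrm: "x \<in> L \<Longrightarrow> norm_L \<sigma> x = of_real (nrm x)"
  using cmod_sq_conj[of x] by (simp add: norm_L_def nrm_def mult.assoc)

lemma nrm_mult: "x \<in> L \<Longrightarrow> y \<in> L \<Longrightarrow> nrm (x * y) = nrm x * nrm y"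
  by (simp add: nrm_def cj_mult norm_mult power_mult_distrib)

lemma nrm_Rats: "x \<in> \<rat> \<Longrightarrow> nrm x = x ^ 3"
  by (simp add: nrm_def cj_Rats power2_eq_square power3_eq_cube abs_mult_self_eq)

lemma nrm_delta: "nrm \<delta> = d"
proof -
  have "cmod \<zeta> ^ 2 = 1"
    unfolding cmod_power2 using zeta_Re_Im by (simp add: power2_eq_square)
  then show ?thesis
    unfolding delta3[symmetric] by (simp add: nrm_def cj_delta norm_mult power_mult_distrib flip: power_Suc)
qed

lemma nrm_power: "x \<in> L \<Longrightarrow> nrm (x ^ n) = nrm x ^ n"
  by (induction n) (simp_all add: nrm_mult L_closed nrm_Rats)

lemma nrm_pos: "x \<in> L \<Longrightarrow> x > 0 \<Longrightarrow> nrm x > 0"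
  using cj_eq_0_iff by (simp add: nrm_def)

lemma nrm_pos_iff: "x \<in> L \<Longrightarrow> nrm x > 0 \<longleftrightarrow> x > 0"
  by (simp add: nrm_def zero_less_mult_iff) (metis cj_eq_0_iff norm_zero zero_less_norm_iff nrm_def)

lemma cmod_cj_sq:
  fixes a b c :: real
  assumes "a \<in> \<rat>" "b \<in> \<rat>" "c \<in> \<rat>"
  shows "(cmod (cj (span3 a b c)))\<^sup>2 = span3 (a\<^sup>2 - d * b * c) (d * c\<^sup>2 - a * b) (b\<^sup>2 - a * c)"
proof -
  have *: "cj (span3 a b c) = of_real (a - c * \<delta>\<^sup>2) + of_real (b * \<delta> - c * \<delta>\<^sup>2) * \<zeta>"
    unfolding cj_span3[OF assms] zeta_quad by (simp add: algebra_simps)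
  have "(cmod (cj (span3 a b c)))\<^sup>2 =
      (a - c * \<delta>\<^sup>2 - (b * \<delta> - c * \<delta>\<^sup>2) / 2)\<^sup>2 + (b * \<delta> - c * \<delta>\<^sup>2)\<^sup>2 * (3 / 4)"
    unfolding * cmod_power2 by (simp add: zeta_Re_Im power_mult_distrib)
  also have "\<dots> = span3 (a\<^sup>2 - d * b * c) (d * c\<^sup>2 - a * b) (b\<^sup>2 - a * c)"
    unfolding span3_norm_cofactor by (simp add: field_simps power2_eq_square)
  finally show ?thesis .
qed

lemma nrm_in_Rats:
  assumes "x \<in> L"
  shows "nrm x \<in> \<rat>"
proof -
  obtain a b c where *: "a \<in> \<rat>" "b \<in> \<rat>" "c \<in> \<rat>" "x = span3 a b c"
    using assms L_iff by blast
  then have "nrm x = a ^ 3 + d * b ^ 3 + d\<^sup>2 * c ^ 3 - 3 * d * a * b * c"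
    using cmod_cj_sq[OF *(1-3)] span3_norm[of a b c] by (simp add: nrm_def)
  then show ?thesis using *(1-3) by simp
qed

lemma cj_algebraic_int: "x \<in> int_L \<delta> \<Longrightarrow> algebraic_int (cj x)"
  by (simp add: int_L_def conj1_def sigma_algebraic_int_iff L_sub_K)

text \<open>The norm is rational by the coordinate formula and an algebraic integer as a product of
  conjugates.\<close>

lemma nrm_int:
  assumes "x \<in> int_L \<delta>"
  shows "nrm x \<in> \<int>"
proof -
  have x: "x \<in> L" "algebraic_int x" using assms by (auto simp: int_L_def)
  have "algebraic_int (of_real x * (cj x * cnj (cj x)))"
    using x cj_algebraic_int[OF assms] by (intro algebraic_int_mult algebraic_int_cnj) auto
  also have "of_real x * (cj x * cnj (cj x)) = complex_of_real (nrm x)"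
    by (simp only: nrm_def of_real_mult complex_norm_square)
  finally have "algebraic_int (nrm x)" by simp
  then show ?thesis using nrm_in_Rats[OF x(1)] rational_algebraic_int_is_int by blast
qed

lemma int_L_add: "x \<in> int_L \<delta> \<Longrightarrow> y \<in> int_L \<delta> \<Longrightarrow> x + y \<in> int_L \<delta>"
  by (simp add: int_L_def L_closed(3) algebraic_int_add)

lemma int_L_mult: "x \<in> int_L \<delta> \<Longrightarrow> y \<in> int_L \<delta> \<Longrightarrow> x * y \<in> int_L \<delta>"
  by (simp add: int_L_def L_closed(4) algebraic_int_mult)

lemma int_L_minus: "x \<in> int_L \<delta> \<Longrightarrow> - x \<in> int_L \<delta>"
  by (simp add: int_L_def L_closed(5) algebraic_int_minus)

lemma int_L_power: "x \<in> int_L \<delta> \<Longrightarrow> x ^ n \<in> int_L \<delta>"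
  by (simp add: int_L_def L_closed(9) algebraic_int_power)

lemma int_L_of_int: "of_int k \<in> int_L \<delta>"
  by (simp add: int_L_def L_closed(10))

lemma int_L_delta: "\<delta> \<in> int_L \<delta>"
  by (simp add: int_L_def L_delta delta_alg_int)


section \<open>Positive units\<close>

abbreviation "Up \<equiv> pos_units_L \<delta>"

lemma int_L_in_L: "x \<in> int_L \<delta> \<Longrightarrow> x \<in> L"
  by (simp add: int_L_def)

lemma Up_iff: "x \<in> Up \<longleftrightarrow> x > 0 \<and> x \<in> int_L \<delta> \<and> inverse x \<in> int_L \<delta>"
proof
  assume "x \<in> Up"
  then obtain y where "x > 0" "x \<in> int_L \<delta>" "y \<in> int_L \<delta>" "x * y = 1"
    by (auto simp: pos_units_L_def units_L_def)
  then show "x > 0 \<and> x \<in> int_L \<delta> \<and> inverse x \<in> int_L \<delta>"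
    using inverse_unique by blast
next
  assume "x > 0 \<and> x \<in> int_L \<delta> \<and> inverse x \<in> int_L \<delta>"
  then show "x \<in> Up"
    unfolding pos_units_L_def units_L_def by (auto intro!: bexI[of _ "inverse x"])
qed

lemma Up_mult: "x \<in> Up \<Longrightarrow> y \<in> Up \<Longrightarrow> x * y \<in> Up"
  by (simp add: Up_iff int_L_mult)

lemma Up_inverse: "x \<in> Up \<Longrightarrow> inverse x \<in> Up"
  by (simp add: Up_iff)

lemma Up_one: "1 \<in> Up"
  using int_L_of_int[of 1] by (simp add: Up_iff)

lemma Up_power: "x \<in> Up \<Longrightarrow> x ^ n \<in> Up"
  by (induction n) (simp_all add: Up_one Up_mult)

lemma Up_power_int: "x \<in> Up \<Longrightarrow> x powi m \<in> Up"
  unfolding power_int_def by (simp add: Up_power Up_inverse)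

lemma Up_pos: "x \<in> Up \<Longrightarrow> x > 0"
  and Up_int_L: "x \<in> Up \<Longrightarrow> x \<in> int_L \<delta>"
  and Up_L: "x \<in> Up \<Longrightarrow> x \<in> L"
  by (simp_all add: Up_iff int_L_in_L)

lemma units_L_nrm:
  assumes "x \<in> units_L \<delta>"
  shows "nrm x = 1 \<or> nrm x = -1"
proof -
  obtain y where xy: "x \<in> int_L \<delta>" "y \<in> int_L \<delta>" "x * y = 1"
    using assms by (auto simp: units_L_def)
  then obtain m n where mn: "nrm x = of_int m" "nrm y = of_int n"
    using nrm_int by (meson Ints_cases)
  have "nrm x * nrm y = 1"
    using nrm_mult[of x y] nrm_Rats[of 1] xy int_L_in_L by simp
  then have "m * n = 1" unfolding mn by (metis of_int_eq_1_iff of_int_mult)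
  then have "m = 1 \<or> m = -1" using zmult_eq_1_iff by blast
  then show ?thesis using mn by auto
qed

lemma Up_nrm: "x \<in> Up \<Longrightarrow> nrm x = 1"
  using units_L_nrm[of x] nrm_pos[OF Up_L Up_pos, of x] by (auto simp: pos_units_L_def)

text \<open>The coefficients are bounded because both conjugates of \<open>u > 1\<close> have absolute value at most 1.\<close>

lemma Up_cubic:
  assumes u: "u \<in> Up" "1 < u" "u \<le> B"
  obtains T S :: int where "u ^ 3 - of_int T * u ^ 2 + of_int S * u - 1 = 0"
    "\<bar>of_int T\<bar> \<le> B + 2" "\<bar>of_int S\<bar> \<le> 2 * B + 1"
proof -
  obtain a b c where *: "a \<in> \<rat>" "b \<in> \<rat>" "c \<in> \<rat>" "u = span3 a b c"
    using Up_L[OF u(1)] L_iff by blast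
  define w where "w = cj u"
  \<comment> \<open>\<open>t\<close> and \<open>s\<close> are the first two elementary symmetric
    functions of the conjugates u, w, cnj w; the third is the norm 1. Coordinates show that they are
    rational, hence integers.\<close>
  define t where "t = u + 2 * Re w"
  define s where "s = 2 * u * Re w + (cmod w)\<^sup>2"
  have w1: "u * (cmod w)\<^sup>2 = 1" using Up_nrm[OF u(1)] by (simp add: nrm_def w_def)
  have w2: "(cmod w)\<^sup>2 \<le> 1"
    using mult_right_mono[of 1 u "(cmod w)\<^sup>2"] u(2) w1 by simp
  then have "cmod w \<le> 1" by (simp add: power_le_one_iff)
  then have Re: "\<bar>Re w\<bar> \<le> 1" using abs_Re_le_cmod[of w] by linarith
  have aiw: "algebraic_int w" "algebraic_int (cnj w)" "algebraic_int (complex_of_real u)"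
    using cj_algebraic_int[OF Up_int_L[OF u(1)]] Up_int_L[OF u(1)]
    by (simp_all add: w_def algebraic_int_cnj int_L_def)
  have Rew: "Re w = a - (b * \<delta> + c * \<delta>\<^sup>2) / 2"
    unfolding w_def *(4) cj_span3[OF *(1-3)] zeta_quad by (simp add: zeta_Re_Im(1) field_simps)
  have tr: "t = 3 * a" unfolding t_def Rew by (simp add: *(4) span3_def)
  have cw: "(cmod w)\<^sup>2 = span3 (a\<^sup>2 - d * b * c) (d * c\<^sup>2 - a * b) (b\<^sup>2 - a * c)"
    unfolding w_def *(4) by (rule cmod_cj_sq[OF *(1-3)])
  have "s = 2 * span3 a b c * (a - (b * \<delta> + c * \<delta>\<^sup>2) / 2) + span3 (a\<^sup>2 - d * b * c) (d * c\<^sup>2 - a * b) (b\<^sup>2 - a * c)"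
    unfolding s_def Rew cw by (simp only: *(4))
  also have "\<dots> = 3 * (a\<^sup>2 - d * b * c)"
    unfolding delta3[symmetric] span3_def by (simp add: field_simps power2_eq_square power3_eq_cube)
  finally have sr: "s = 3 * (a\<^sup>2 - d * b * c)" .
  have "complex_of_real t = of_real u + (w + cnj w)"
    by (simp add: t_def complex_add_cnj)
  then have "algebraic_int t"
    using algebraic_int_add[OF aiw(3) algebraic_int_add[OF aiw(1,2)]] by (metis algebraic_int_of_real_iff)
  then have ti: "t \<in> \<int>"
    by (rule rational_algebraic_int_is_int) (simp add: tr *(1))
  have "complex_of_real s = of_real u * (w + cnj w) + w * cnj w"
    by (simp add: s_def complex_add_cnj complex_mult_cnj cmod_power2)
  then have "algebraic_int s"
    using algebraic_int_add[OF algebraic_int_mult[OF aiw(3) algebraic_int_add[OF aiw(1,2)]] algebraic_int_mult[OF aiw(1,2)]]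
    by (metis algebraic_int_of_real_iff)
  then have si: "s \<in> \<int>"
    by (rule rational_algebraic_int_is_int) (simp add: sr *(1-3))
  obtain T S where TS: "t = of_int T" "s = of_int S"
    using ti si by (auto elim!: Ints_cases)
  have "u ^ 3 - t * u ^ 2 + s * u - u * (cmod w)\<^sup>2 = 0"
    by (simp add: t_def s_def algebra_simps power2_eq_square power3_eq_cube)
  then have "u ^ 3 - of_int T * u ^ 2 + of_int S * u - 1 = 0"
    unfolding w1 TS .
  moreover have "\<bar>of_int T\<bar> \<le> B + 2"
    unfolding TS(1)[symmetric] t_def using Re u by linarith
  moreover have "\<bar>of_int S\<bar> \<le> 2 * B + 1"
  proof -
    have "\<bar>u * Re w\<bar> \<le> B * 1"
      unfolding abs_mult using Re u by (intro mult_mono) auto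
    then show ?thesis
      unfolding TS(2)[symmetric] s_def using w2 zero_le_power2[of "cmod w"] by linarith
  qed
  ultimately show thesis using that by blast
qed

text \<open>Such units are roots of finitely many integer cubics, each with finitely many
  roots.\<close>

lemma finite_Up_bounded: "finite {u \<in> Up. 1 < u \<and> u \<le> B}"
proof -
  define M where "M = \<lceil>2 * B + 2\<rceil>"
  define R where "R = (\<lambda>(T, S). {x :: real. poly [:-1, of_int S, - of_int T, 1:] x = 0})"
  have "{u \<in> Up. 1 < u \<and> u \<le> B} \<subseteq> (\<Union>TS \<in> {-M..M} \<times> {-M..M}. R TS)"
  proof
    fix u assume u: "u \<in> {u \<in> Up. 1 < u \<and> u \<le> B}"
    then obtain T S :: int where TS: "u ^ 3 - of_int T * u ^ 2 + of_int S * u - 1 = 0"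
      "\<bar>of_int T\<bar> \<le> B + 2" "\<bar>of_int S\<bar> \<le> 2 * B + 1"
      using Up_cubic[of u B] by blast
    have B: "1 < B" using u by simp
    have M: "2 * B + 2 \<le> of_int M" unfolding M_def by simp
    have "\<bar>of_int T\<bar> \<le> real_of_int M" "\<bar>of_int S\<bar> \<le> real_of_int M" using TS(2,3) B M by linarith+
    then have "T \<in> {-M..M}" "S \<in> {-M..M}" by (simp_all add: abs_le_iff)
    moreover have "u \<in> R (T, S)"
      using TS(1) by (simp add: R_def algebra_simps power2_eq_square power3_eq_cube)
    ultimately show "u \<in> (\<Union>TS \<in> {-M..M} \<times> {-M..M}. R TS)" by blast
  qed
  moreover have "finite (R TS)" for TS
    unfolding R_def by (cases TS) (simp only: prod.case, rule poly_roots_finite, simp)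
  ultimately show ?thesis by (meson finite_SigmaI finite_UN_I finite_atLeastAtMost_int finite_subset)
qed

text \<open>If some unit exceeds 1, there is a least one \<epsilon>, by finiteness. Dividing
  \<theta> by the power of \<epsilon> just below it leaves a unit in [1, \<epsilon>), which is
  1.\<close>

lemma Up_cyclic:
  obtains \<epsilon> where "\<epsilon> \<in> Up" "\<And>\<theta>. \<theta> \<in> Up \<Longrightarrow> \<exists>m::int. \<theta> = \<epsilon> powi m"
proof (cases "\<exists>u\<in>Up. 1 < u")
  case False
  have "\<theta> = 1" if "\<theta> \<in> Up" for \<theta>
  proof (rule ccontr)
    assume "\<theta> \<noteq> 1"
    then have "1 < \<theta> \<or> 1 < inverse \<theta>"
      using Up_pos[OF that] by (auto simp: one_less_inverse_iff)
    then show False using False that Up_inverse by blast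
  qed
  then show thesis using that[of 1] Up_one by auto
next
  case True
  then obtain u where u: "u \<in> Up" "1 < u" by blast
  define F where "F = {v \<in> Up. 1 < v \<and> v \<le> u}"
  define \<epsilon> where "\<epsilon> = Min F"
  have fin: "finite F" "F \<noteq> {}" using finite_Up_bounded[of u] u by (auto simp: F_def)
  then have "\<epsilon> \<in> F" unfolding \<epsilon>_def by (rule Min_in)
  then have e: "\<epsilon> \<in> Up" "1 < \<epsilon>" "\<epsilon> \<le> u" by (auto simp: F_def)
  have least: "\<epsilon> \<le> v" if v: "v \<in> Up" "1 < v" for v
  proof (cases "v \<le> u")
    case True
    then show ?thesis unfolding \<epsilon>_def using fin v by (intro Min_le) (auto simp: F_def)
  qed (use e in simp)
  have "\<exists>m::int. \<theta> = \<epsilon> powi m" if th: "\<theta> \<in> Up" for \<theta>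
  proof -
    define m where "m = \<lfloor>log \<epsilon> \<theta>\<rfloor>"
    have th0: "\<theta> > 0" using Up_pos[OF th] .
    have "\<epsilon> powr (of_int m) \<le> \<epsilon> powr (log \<epsilon> \<theta>)"
      using e(2) unfolding m_def by simp
    then have le: "\<epsilon> powi m \<le> \<theta>"
      using e(2) th0 by (simp add: powr_real_of_int' )
    have "\<epsilon> powr (log \<epsilon> \<theta>) < \<epsilon> powr (of_int (m + 1))"
      using e(2) unfolding m_def by (intro powr_less_mono) (simp_all only: real_of_int_floor_add_one_gt of_int_add of_int_1)
    then have "\<theta> < \<epsilon> powi (m + 1)"
      using powr_real_of_int'[of \<epsilon> "m + 1"] e(2) th0 by simp
    then have lt: "\<theta> < \<epsilon> powi m * \<epsilon>" using e(2) by (simp add: power_int_add_1)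
    define v where "v = \<theta> * inverse (\<epsilon> powi m)"
    have pm: "\<epsilon> powi m > 0" using e(2) by (intro zero_less_power_int) simp
    have v: "v \<in> Up" unfolding v_def by (intro Up_mult Up_inverse Up_power_int th e(1))
    have "v < \<epsilon>" "1 \<le> v"
      using lt le pm by (simp_all add: v_def field_simps)
    then have "v = 1" using least[OF v] by fastforce
    then have "\<theta> = \<epsilon> powi m" using pm by (simp add: v_def field_simps)
    then show ?thesis by blast
  qed
  then show thesis using that e(1) by blast
qed

text \<open>A cyclic group modulo cubes has order at most 3, so any non-cube generates the
  quotient.\<close>

lemma Up_mod_cubes:
  assumes e: "\<epsilon> \<in> Up" and nc: "\<And>\<eta>. \<eta> \<in> Up \<Longrightarrow> \<epsilon> \<noteq> \<eta> ^ 3" and th: "\<theta> \<in> Up"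
  obtains i \<eta> where "i < (3::nat)" "\<eta> \<in> Up" "\<theta> = \<epsilon> ^ i * \<eta> ^ 3"
proof -
  obtain \<xi> where xi: "\<xi> \<in> Up" "\<And>\<theta>. \<theta> \<in> Up \<Longrightarrow> \<exists>m::int. \<theta> = \<xi> powi m"
    using Up_cyclic by blast
  obtain l m where lm: "\<epsilon> = \<xi> powi l" "\<theta> = \<xi> powi m"
    using xi(2) e th by meson
  have xi0: "\<xi> \<noteq> 0" using Up_pos[OF xi(1)] by simp
  have cube: "(\<xi> powi q) ^ 3 = \<xi> powi (3 * q)" for q
    by (simp add: power_int_mult mult.commute[of 3 q])
  have l: "l mod 3 \<noteq> 0"
  proof
    assume "l mod 3 = 0"
    then obtain q where "l = 3 * q" by auto
    then have "\<epsilon> = (\<xi> powi q) ^ 3" using cube lm(1) by simp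
    then show False using nc[OF Up_power_int[OF xi(1)]] by blast
  qed
  \<comment> \<open>With \<epsilon> = \<xi>^l and \<theta> = \<xi>^m, the exponent must solve l i =
    m modulo 3. Since l^2 = 1 there, l is its own inverse.\<close>
  define i where "i = nat ((l * m) mod 3)"
  have i: "i < 3" unfolding i_def by simp
  have ii: "int i = (l * m) mod 3" unfolding i_def by simp
  have "(m - l * int i) mod 3 = 0"
  proof -
    have "l mod 3 = 1 \<or> l mod 3 = 2" using l by presburger
    then have "(l * l) mod 3 = 1"
      by (subst mod_mult_eq[symmetric]) auto
    then have "(l * l * m) mod 3 = m mod 3" by (metis mod_mult_left_eq mult_1)
    then have "(l * int i) mod 3 = m mod 3" unfolding ii by (simp add: mod_mult_right_eq mult.assoc)
    then show ?thesis by (metis cong_def mod_diff_cong diff_self mod_0)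
  qed
  then obtain q where q: "m - l * int i = 3 * q" by auto
  have "\<theta> = \<xi> powi (l * int i + 3 * q)" unfolding lm(2) q[symmetric] by simp
  also have "\<dots> = \<epsilon> ^ i * (\<xi> powi q) ^ 3"
    unfolding lm(1) cube using xi0 by (simp add: power_int_add power_int_mult)
  finally show thesis using that[OF i Up_power_int[OF xi(1)]] by blast
qed

section \<open>Ambiguous elements\<close>

text \<open>Ambiguity gives \<beta>' = \<beta> w and \<beta> = \<beta>' s with integers w, s of k.
  Then \<beta>^3 / N(\<beta>) = \<beta>^2 / |\<beta>'|^2 = |s|^2, with inverse |w|^2, and both are
  integral.\<close>

lemma ambiguous_unit:
  assumes b: "\<beta> \<in> ambiguous_L \<delta> \<zeta> \<sigma>" "\<beta> > 0"
  shows "\<beta> ^ 3 / nrm \<beta> \<in> Up"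
proof -
  let ?b = "complex_of_real \<beta>"
  have bL: "\<beta> \<in> L" and amb: "\<sigma> ` ((\<lambda>x. ?b * x) ` int_k \<delta> \<zeta>) = (\<lambda>x. ?b * x) ` int_k \<delta> \<zeta>"
    using b by (auto simp: ambiguous_L_def)
  have one: "1 \<in> int_k \<delta> \<zeta>" by (simp add: int_k_def K_closed)
  have c0: "cj \<beta> \<noteq> 0" using cj_eq_0_iff[OF bL] b(2) by simp
  have "cj \<beta> \<in> \<sigma> ` ((\<lambda>x. ?b * x) ` int_k \<delta> \<zeta>)"
    using one unfolding conj1_def by (metis imageI mult.right_neutral)
  then obtain w where w: "w \<in> int_k \<delta> \<zeta>" "cj \<beta> = ?b * w"
    unfolding amb by blast
  have "?b \<in> \<sigma> ` ((\<lambda>x. ?b * x) ` int_k \<delta> \<zeta>)"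
    unfolding amb using one by (metis imageI mult.right_neutral)
  then obtain v where v: "v \<in> int_k \<delta> \<zeta>" "?b = \<sigma> (?b * v)"
    by blast
  define s where "s = \<sigma> v"
  have s: "?b = cj \<beta> * s"
    using v sigma_mult[OF L_sub_K[OF bL], of v] by (simp add: s_def conj1_def int_k_def)
  have ais: "algebraic_int s" using v sigma_algebraic_int_iff by (simp add: s_def int_k_def)
  have aiw: "algebraic_int w" using w by (simp add: int_k_def)
  have e: "\<beta> ^ 3 / nrm \<beta> = \<beta>\<^sup>2 / (cmod (cj \<beta>))\<^sup>2"
    using b(2) by (simp add: nrm_def power2_eq_square power3_eq_cube)
  have "cmod ?b = cmod (cj \<beta> * s)" using s by (rule arg_cong)
  then have "\<bar>\<beta>\<bar> = cmod (cj \<beta>) * cmod s" by (simp only: norm_mult norm_of_real)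
  then have "\<bar>\<beta>\<bar>\<^sup>2 = (cmod (cj \<beta>))\<^sup>2 * (cmod s)\<^sup>2" by (simp only: power_mult_distrib)
  then have s2: "\<beta> ^ 3 / nrm \<beta> = (cmod s)\<^sup>2"
    unfolding e using c0 by (simp add: field_simps)
  have w2: "inverse (\<beta> ^ 3 / nrm \<beta>) = (cmod w)\<^sup>2"
    unfolding e w(2) using b(2) by (simp add: norm_mult power_mult_distrib)
  have "algebraic_int ((cmod s)\<^sup>2)" "algebraic_int ((cmod w)\<^sup>2)"
    using algebraic_int_mult[OF ais algebraic_int_cnj[OF ais]] algebraic_int_mult[OF aiw algebraic_int_cnj[OF aiw]]
    unfolding complex_norm_square[symmetric] of_real_power[symmetric] algebraic_int_of_real_iff by simp_all
  moreover have "\<beta> ^ 3 / nrm \<beta> \<in> L"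
    using bL nrm_in_Rats[OF bL] by (simp add: L_closed(8,9,11))
  moreover have "\<beta> ^ 3 / nrm \<beta> > 0" using b(2) nrm_pos[OF bL] by simp
  ultimately show ?thesis
    unfolding Up_iff int_L_def s2[symmetric] w2[symmetric] using L_closed(6) by blast
qed

lemma cube_roots_of_unity:
  assumes "t ^ 3 = 1"
  shows "t = 1 \<or> t = \<zeta> \<or> t = \<zeta>\<^sup>2"
proof -
  have "(t - 1) * (t - \<zeta>) * (t - \<zeta>\<^sup>2) = t ^ 3 - 1 - (1 + \<zeta> + \<zeta>\<^sup>2) * (t\<^sup>2 - t * \<zeta>) - (\<zeta> ^ 3 - 1)"
    by (simp add: algebra_simps power2_eq_square power3_eq_cube)
  also have "\<dots> = 0" using assms zeta3 zeta_quad by simp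
  finally show ?thesis by auto
qed

text \<open>The cube of x'/x is 1, so x' is x, \<zeta> x or \<zeta>^2 x, and comparing coordinates
  leaves a single term of x.\<close>

lemma rational_cube_L:
  assumes x: "x \<in> L" "x ^ 3 \<in> \<rat>"
  obtains r j where "r \<in> \<rat>" "j < (3::nat)" "x = r * \<delta> ^ j"
proof (cases "x = 0")
  case True
  then show thesis using that[of 0 0] by simp
next
  case False
  obtain a b c where *: "a \<in> \<rat>" "b \<in> \<rat>" "c \<in> \<rat>" "x = span3 a b c"
    using x(1) L_iff by blast
  have xs: "x = a + b * \<delta> + c * \<delta>\<^sup>2" using *(4) by (simp add: span3_def)
  have c: "cj x = of_real a + of_real (b * \<delta>) * \<zeta> + of_real (c * \<delta>\<^sup>2) * \<zeta>\<^sup>2"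
    unfolding *(4) by (rule cj_span3[OF *(1-3)])
  have "cj x ^ 3 = of_real x ^ 3"
    using cj_power[OF x(1), of 3] cj_Rats[OF x(2)] by simp
  then have "(cj x / of_real x) ^ 3 = 1" using False by (simp add: power_divide)
  then have "cj x / of_real x = 1 \<or> cj x / of_real x = \<zeta> \<or> cj x / of_real x = \<zeta>\<^sup>2"
    by (rule cube_roots_of_unity)
  then consider "cj x = of_real x" | "cj x = of_real x * \<zeta>" | "cj x = of_real x * \<zeta>\<^sup>2"
    using False by (auto simp: field_simps)
  then show thesis
  proof cases
    case 1
    then have "of_real (a - x) + of_real (b * \<delta>) * \<zeta> + of_real (c * \<delta>\<^sup>2) * \<zeta>\<^sup>2 = 0"
      unfolding c by (simp add: algebra_simps)
    \<comment> \<open>The three coefficients are equal and their sum is a + b \<delta> + c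
      \<delta>^2 - x = 0, so each of them is 0.\<close>
    from zeta_relation[OF this] have "x = a" using xs by linarith
    then show thesis using that[of a 0] * by simp
  next
    case 2
    then have "of_real a + of_real (b * \<delta> - x) * \<zeta> + of_real (c * \<delta>\<^sup>2) * \<zeta>\<^sup>2 = 0"
      unfolding c by (simp add: algebra_simps)
    from zeta_relation[OF this] have "x = b * \<delta>" using xs by linarith
    then show thesis using that[of b 1] * by simp
  next
    case 3
    then have "of_real a + of_real (b * \<delta>) * \<zeta> + of_real (c * \<delta>\<^sup>2 - x) * \<zeta>\<^sup>2 = 0"
      unfolding c by (simp add: algebra_simps)
    from zeta_relation[OF this] have "x = c * \<delta>\<^sup>2" using xs by linarith
    then show thesis using that[of c 2] * by simp
  qed
qed

text \<open>Hypothesis \<open>na\<close> makes the unit of \<alpha> a non-cube: were it \<eta>^3,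
  then \<alpha>/\<eta> would have a rational cube. The power \<open>i\<close> matches the unit of
  \<beta> up to a cube, after which \<beta>/(\<alpha>^i \<eta>) has a rational cube.\<close>

lemma ambiguous_decompose:
  assumes a: "\<alpha> \<in> ambiguous_L \<delta> \<zeta> \<sigma>" "\<alpha> > 0"
    and na: "\<And>r j \<eta>. r \<in> \<rat> \<Longrightarrow> \<eta> \<in> Up \<Longrightarrow> \<alpha> \<noteq> r * \<delta> ^ j * \<eta>"
    and b: "\<beta> \<in> ambiguous_L \<delta> \<zeta> \<sigma>" "\<beta> > 0"
  obtains i j r \<eta> where "i < (3::nat)" "r \<in> \<rat>" "r > 0" "\<eta> \<in> Up" "\<beta> = r * \<delta> ^ j * \<alpha> ^ i * \<eta>"
proof -
  define ea eb where "ea = \<alpha> ^ 3 / nrm \<alpha>" and "eb = \<beta> ^ 3 / nrm \<beta>"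
  have U: "ea \<in> Up" "eb \<in> Up"
    unfolding ea_def eb_def using ambiguous_unit a b by auto
  have aL: "\<alpha> \<in> L" and bL: "\<beta> \<in> L" using a b by (auto simp: ambiguous_L_def)
  have na0: "nrm \<alpha> > 0" and nb0: "nrm \<beta> > 0" using nrm_pos aL bL a b by auto
  have nc: "ea \<noteq> \<eta> ^ 3" if h: "\<eta> \<in> Up" for \<eta>
  proof
    assume "ea = \<eta> ^ 3"
    then have "(\<alpha> / \<eta>) ^ 3 = nrm \<alpha>"
      unfolding ea_def using na0 Up_pos[OF h] by (simp add: power_divide field_simps)
    then have "(\<alpha> / \<eta>) ^ 3 \<in> \<rat>" using nrm_in_Rats[OF aL] by simp
    then obtain r j where rj: "r \<in> \<rat>" "\<alpha> / \<eta> = r * \<delta> ^ j"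
      using rational_cube_L[of "\<alpha> / \<eta>"] L_closed(8)[OF aL Up_L[OF h]] by metis
    have "\<alpha> = (\<alpha> / \<eta>) * \<eta>" using Up_pos[OF h] by simp
    also have "\<dots> = r * \<delta> ^ j * \<eta>" unfolding rj(2) ..
    finally show False using na[OF rj(1) h] by blast
  qed
  obtain i \<eta> where i: "i < 3" "\<eta> \<in> Up" "eb = ea ^ i * \<eta> ^ 3"
    using Up_mod_cubes[OF U(1) nc U(2)] by metis
  define x where "x = \<beta> / (\<alpha> ^ i * \<eta>)"
  have h0: "\<eta> > 0" using Up_pos[OF i(2)] .
  have xL: "x \<in> L" unfolding x_def using aL bL Up_L[OF i(2)] by (simp add: L_closed(4,8,9))
  have x0: "x > 0" unfolding x_def using a(2) b(2) h0 by simp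
  have b3: "\<beta> ^ 3 = nrm \<beta> * eb" using nb0 by (simp add: eb_def)
  have a3: "\<alpha> ^ 3 = nrm \<alpha> * ea" using na0 by (simp add: ea_def)
  have "(\<alpha> ^ i * \<eta>) ^ 3 = (\<alpha> ^ 3) ^ i * \<eta> ^ 3"
    by (simp add: power_mult_distrib flip: power_mult) (simp add: mult.commute)
  also have "\<dots> = nrm \<alpha> ^ i * eb" unfolding a3 i(3) by (simp add: power_mult_distrib)
  finally have "x ^ 3 = nrm \<beta> / nrm \<alpha> ^ i"
    unfolding x_def power_divide b3 using Up_pos[OF U(2)] by simp
  then have "x ^ 3 \<in> \<rat>" using nrm_in_Rats aL bL by simp
  then obtain r j where rj: "r \<in> \<rat>" "x = r * \<delta> ^ j"
    using rational_cube_L[OF xL] by metis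
  have "r > 0" using x0 delta_gt unfolding rj(2) by (simp add: zero_less_mult_iff)
  moreover have "\<beta> = r * \<delta> ^ j * \<alpha> ^ i * \<eta>"
    unfolding rj(2)[symmetric] x_def using a(2) h0 by simp
  ultimately show thesis using that i rj(1) by blast
qed

end

section \<open>Lattice minima\<close>

text \<open>A prime l in the denominator of R would have l^3 dividing \<open>e1 * e2 ^ 2\<close>,
  which is cube-free because \<open>e1 * e2\<close> is squarefree.\<close>

lemma cubefree_rational:
  fixes R :: real and e1 e2 :: int
  assumes "squarefree (e1 * e2)" "R \<in> \<rat>" "R ^ 3 * (of_int e1 * of_int e2 ^ 2) \<in> \<int>"
  shows "R \<in> \<int>"
proof -
  obtain p q where pq: "q > 0" "coprime p q" "R = of_int p / of_int q"
    using assms(2) by (rule Rats_cases')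
  obtain k where k: "R ^ 3 * (of_int e1 * of_int e2 ^ 2) = of_int k"
    using assms(3) by (rule Ints_cases)
  have "real_of_int (p ^ 3 * (e1 * e2 ^ 2)) = real_of_int (k * q ^ 3)"
    using k pq(1) unfolding pq(3) by (simp add: field_simps)
  then have eq: "p ^ 3 * (e1 * e2 ^ 2) = k * q ^ 3" by (simp only: of_int_eq_iff)
  then have "q ^ 3 dvd p ^ 3 * (e1 * e2 ^ 2)" by simp
  moreover have "coprime (q ^ 3) (p ^ 3)" using pq(2) by (simp add: coprime_commute)
  ultimately have q3: "q ^ 3 dvd e1 * e2 ^ 2" by (simp add: coprime_dvd_mult_right_iff)
  have "is_unit q"
  proof (rule ccontr)
    assume "\<not> is_unit q"
    then obtain l where l: "prime l" "l dvd q"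
      using pq(1) prime_divisorE[of q] by auto
    have l3: "l ^ 3 dvd e1 * e2 ^ 2"
      using q3 l(2) by (meson dvd_power_same dvd_trans)
    have sq: "\<not> l ^ 2 dvd e1 * e2"
      using assms(1) l(1) unfolding squarefree_def by auto
    show False
    proof (cases "l dvd e2")
      case True
      \<comment> \<open>Squarefreeness puts l in only one of the two factors and only once, so
        \<open>e2 ^ 2\<close> cannot absorb l^3.\<close>
      then have "\<not> l dvd e1"
        using sq mult_dvd_mono[of l e1 l e2] by (auto simp: power2_eq_square)
      then have "coprime (l ^ 3) e1" using l(1) by (simp add: prime_imp_coprime)
      then have "l ^ 3 dvd e2 ^ 2" using l3 by (simp add: coprime_dvd_mult_right_iff)
      obtain f where f: "e2 = l * f" using True by blast
      have "l ^ 2 * l dvd l ^ 2 * f ^ 2"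
        using \<open>l ^ 3 dvd e2 ^ 2\<close> by (simp add: f power2_eq_square power3_eq_cube ac_simps)
      then have "l dvd f ^ 2" using l(1) by simp
      then have "l dvd f" using l(1) prime_dvd_power by blast
      then have "l ^ 2 dvd e2" unfolding f power2_eq_square by simp
      then show False using sq by simp
    next
      case False
      then have "coprime (l ^ 3) (e2 ^ 2)" using l(1) by (simp add: prime_imp_coprime)
      then have "l ^ 3 dvd e1" using l3 by (simp add: coprime_dvd_mult_left_iff)
      then have "l ^ 2 dvd e1" using power_le_dvd[of l 3 e1 2] by simp
      then show False using sq by simp
    qed
  qed
  then have "q = 1" using pq(1) by simp
  then show ?thesis using pq(3) by simp
qed

context pure_cubic
begin

abbreviation "Minima \<equiv> lattice_minima \<delta> \<sigma>"

lemma Minima_iff: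
  "\<beta> \<in> Minima \<longleftrightarrow> \<beta> \<in> int_L \<delta> \<and> \<beta> > 0 \<and>
     (\<forall>\<theta>\<in>int_L \<delta>. cmod (cj \<theta>) < cmod (cj \<beta>) \<and> 0 \<le> \<theta> \<and> \<theta> < \<beta> \<longrightarrow> \<theta> = 0)"
proof -
  have *: "Re (cj x * conj2 \<sigma> x) = (cmod (cj x))\<^sup>2" if "x \<in> int_L \<delta>" for x
    unfolding cmod_sq_conj[OF int_L_in_L[OF that]] by (rule Re_complex_of_real)
  have sq: "(cmod x)\<^sup>2 < (cmod y)\<^sup>2 \<longleftrightarrow> cmod x < cmod y" for x y :: complex
    by (meson norm_ge_zero power_strict_mono power2_less_imp_less zero_less_numeral)
  show ?thesis
  proof (cases "\<beta> \<in> int_L \<delta>")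
    case True
    show ?thesis
      unfolding lattice_minima_def by (simp only: mem_Collect_eq * True sq cong: ball_cong)
  next
    case False
    then show ?thesis by (simp add: lattice_minima_def)
  qed
qed

lemma cj_minus: "x \<in> L \<Longrightarrow> cj (- x) = - cj x"
  using cj_mult[of "- 1" x] cj_Rats[of "- 1"] L_closed(11)[of "- 1"] by simp

text \<open>Either \<theta> or its negative is admissible in the definition. The absolute value
  matters because the competitor with s = t = -1 is negative.\<close>

lemma not_MinimaI:
  assumes "\<theta> \<in> int_L \<delta>" "\<theta> \<noteq> 0" "\<bar>\<theta>\<bar> < \<beta>" "cmod (cj \<theta>) < cmod (cj \<beta>)"
  shows "\<beta> \<notin> Minima"
proof (cases "\<theta> \<ge> 0")
  case True
  then show ?thesis using assms unfolding Minima_iff by auto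
next
  case False
  have "- \<theta> \<in> int_L \<delta>" "cmod (cj (- \<theta>)) < cmod (cj \<beta>)"
    using assms(1,4) by (simp_all add: int_L_minus cj_minus int_L_in_L)
  moreover have "0 \<le> - \<theta>" "- \<theta> < \<beta>" "- \<theta> \<noteq> 0" using False assms(3) by auto
  ultimately show ?thesis unfolding Minima_iff by blast
qed

lemma Minima_unit_cancel:
  assumes "\<beta> * \<eta> \<in> Minima" "\<eta> \<in> Up"
  shows "\<beta> \<in> Minima"
  unfolding Minima_iff
proof (intro conjI ballI impI)
  have e: "\<eta> > 0" "\<eta> \<in> L" "\<eta> \<in> int_L \<delta>" using assms(2) Up_pos Up_L Up_int_L by auto
  have be: "\<beta> * \<eta> \<in> int_L \<delta>" "\<beta> * \<eta> > 0" using assms(1) unfolding Minima_iff by auto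
  have be': "\<beta> * \<eta> * inverse \<eta> = \<beta>" using e by simp
  show b: "\<beta> \<in> int_L \<delta>"
    using int_L_mult[OF be(1) Up_int_L[OF Up_inverse[OF assms(2)]]] unfolding be' .
  show "\<beta> > 0" using be(2) e(1) by (simp add: zero_less_mult_iff)
  fix \<theta> assume th: "\<theta> \<in> int_L \<delta>" and *: "cmod (cj \<theta>) < cmod (cj \<beta>) \<and> 0 \<le> \<theta> \<and> \<theta> < \<beta>"
  have "cmod (cj \<eta>) > 0" using cj_eq_0_iff[OF e(2)] e(1) by simp
  then have "cmod (cj (\<theta> * \<eta>)) < cmod (cj (\<beta> * \<eta>))"
    using * b th e(2) by (simp add: cj_mult int_L_in_L norm_mult)
  moreover have "0 \<le> \<theta> * \<eta>" "\<theta> * \<eta> < \<beta> * \<eta>" using * e(1) by simp_all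
  ultimately have "\<theta> * \<eta> = 0"
    using assms(1) int_L_mult[OF th e(3)] unfolding Minima_iff by blast
  then show "\<theta> = 0" using e by simp
qed

text \<open>An element beating a unit would have an integral norm strictly between 0 and 1.\<close>

lemma Up_subset_Minima: "Up \<subseteq> Minima"
proof
  fix u assume u: "u \<in> Up"
  show "u \<in> Minima"
    unfolding Minima_iff
  proof (intro conjI ballI impI)
    show "u \<in> int_L \<delta>" "u > 0" using u Up_int_L Up_pos by auto
    fix \<theta> assume th: "\<theta> \<in> int_L \<delta>" and *: "cmod (cj \<theta>) < cmod (cj u) \<and> 0 \<le> \<theta> \<and> \<theta> < u"
    show "\<theta> = 0"
    proof (rule ccontr)
      assume "\<theta> \<noteq> 0"
      then have pos: "nrm \<theta> > 0" using * nrm_pos[OF int_L_in_L[OF th]] by simp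
      have "(cmod (cj \<theta>))\<^sup>2 < (cmod (cj u))\<^sup>2" using * by (intro power_strict_mono) auto
      then have "nrm \<theta> < nrm u"
        unfolding nrm_def using * by (intro mult_strict_mono) auto
      then have "nrm \<theta> < 1" using Up_nrm[OF u] by simp
      moreover obtain m where "nrm \<theta> = of_int m" using nrm_int[OF th] by (rule Ints_cases)
      ultimately show False using pos by simp
    qed
  qed
qed

lemma Up_subset_ambiguous: "Up \<subseteq> ambiguous_L \<delta> \<zeta> \<sigma>"
proof
  fix u assume u: "u \<in> Up"
  have k: "complex_of_real v * x \<in> int_k \<delta> \<zeta>" if "v \<in> Up" "x \<in> int_k \<delta> \<zeta>" for v x
    using that Up_int_L[of v] L_sub_K[of v]
    by (simp add: int_k_def int_L_def K_closed(4) algebraic_int_mult)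
  have "(\<lambda>x. complex_of_real u * x) ` int_k \<delta> \<zeta> = int_k \<delta> \<zeta>"
  proof
    show "(\<lambda>x. complex_of_real u * x) ` int_k \<delta> \<zeta> \<subseteq> int_k \<delta> \<zeta>" using k[OF u] by blast
    show "int_k \<delta> \<zeta> \<subseteq> (\<lambda>x. complex_of_real u * x) ` int_k \<delta> \<zeta>"
    proof
      fix x assume "x \<in> int_k \<delta> \<zeta>"
      then have "complex_of_real (inverse u) * x \<in> int_k \<delta> \<zeta>" using k[OF Up_inverse[OF u]] by blast
      moreover have "x = complex_of_real u * (complex_of_real (inverse u) * x)"
        using Up_pos[OF u] by simp
      ultimately show "x \<in> (\<lambda>x. complex_of_real u * x) ` int_k \<delta> \<zeta>" by (rule rev_image_eqI)
    qed
  qed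
  then show "u \<in> ambiguous_L \<delta> \<zeta> \<sigma>"
    using Up_pos[OF u] Up_L[OF u] sigma_int_k by (simp add: ambiguous_L_def)
qed

text \<open>Ambiguity of \<open>\<gamma> \<O>\<^sub>L\<close> enters only through \<open>\<gamma>\<^sup>3 / N(\<gamma>)\<close> being a unit; here \<open>N(\<gamma>) = e\<^sub>1 e\<^sub>2\<^sup>2\<close>, and
  \<open>e\<^sub>1, e\<^sub>2, e\<^sub>3\<close> are the canonical divisors of \<open>d\<close> with respect to it.\<close>

definition ambiguous_gen :: "real \<Rightarrow> int \<Rightarrow> int \<Rightarrow> int \<Rightarrow> bool" where
  "ambiguous_gen \<gamma> e1 e2 e3 \<longleftrightarrow> \<gamma> \<in> L \<and> \<gamma> > 0 \<and> e1 > 0 \<and> e2 > 0 \<and> e3 > 0 \<and> e1 * e2 * e3 = d \<and>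
     (\<exists>\<epsilon>\<in>Up. \<gamma> ^ 3 = of_int e1 * of_int e2 ^ 2 * \<epsilon>)"

text \<open>The cube of \<gamma> is integral, hence so is \<gamma>. This also covers quotients such
  as \<gamma> \<delta> / e2, where integrality is not visible.\<close>

lemma ambiguous_gen_int_L:
  assumes "ambiguous_gen \<gamma> e1 e2 e3"
  shows "\<gamma> \<in> int_L \<delta>"
proof -
  obtain \<epsilon> where e: "\<epsilon> \<in> Up" "\<gamma> ^ 3 = of_int e1 * of_int e2 ^ 2 * \<epsilon>" and g: "\<gamma> \<in> L" "\<gamma> > 0"
    using assms by (auto simp: ambiguous_gen_def)
  have "algebraic_int \<epsilon>" using Up_int_L[OF e(1)] by (simp add: int_L_def)
  then have "algebraic_int (\<gamma> ^ 3)"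
    unfolding e(2) by (intro algebraic_int_mult algebraic_int_power algebraic_int_of_int)
  then have "algebraic_int (root 3 (\<gamma> ^ 3))" by (rule algebraic_int_nth_root_real)
  then show ?thesis using g by (simp add: int_L_def real_root_power_cancel)
qed

lemma ambiguous_gen_nrm:
  assumes "ambiguous_gen \<gamma> e1 e2 e3"
  shows "nrm \<gamma> = of_int e1 * of_int e2 ^ 2"
proof -
  obtain \<epsilon> where e: "\<epsilon> \<in> Up" "\<gamma> ^ 3 = of_int (e1 * e2 ^ 2) * \<epsilon>" and g: "\<gamma> \<in> L" "\<gamma> > 0" "e1 > 0" "e2 > 0"
    using assms by (auto simp: ambiguous_gen_def)
  have "nrm \<gamma> ^ 3 = nrm (\<gamma> ^ 3)" using g by (simp add: nrm_power)
  also have "\<dots> = of_int (e1 * e2 ^ 2) ^ 3"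
    unfolding e(2) using e(1) by (simp only: nrm_mult L_closed(10) Up_L nrm_Rats[OF Rats_of_int] Up_nrm mult_1_right)
  finally have "nrm \<gamma> = of_int (e1 * e2 ^ 2)"
    using g nrm_pos[OF g(1,2)] power_eq_imp_eq_base[of "nrm \<gamma>" 3 "of_int (e1 * e2 ^ 2)"] by simp
  then show ?thesis by simp
qed

text \<open>Multiplying e1 e2^2 by d = e1 e2 e3 and removing the cube e2^3 leaves e3 e1^2. So a
  factor \<delta> permutes the divisors cyclically.\<close>

lemma ambiguous_gen_rotate:
  assumes "ambiguous_gen \<gamma> e1 e2 e3"
  shows "ambiguous_gen (\<gamma> * \<delta> / of_int e2) e3 e1 e2"
proof -
  obtain \<epsilon> where e: "\<epsilon> \<in> Up" "\<gamma> ^ 3 = of_int e1 * of_int e2 ^ 2 * \<epsilon>" and g: "\<gamma> \<in> L" "\<gamma> > 0"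
    and p: "e1 > 0" "e2 > 0" "e3 > 0" and d: "e1 * e2 * e3 = d"
    using assms by (auto simp: ambiguous_gen_def)
  have "(\<gamma> * \<delta> / of_int e2) ^ 3 = of_int e1 * of_int e2 ^ 2 * \<epsilon> * of_int (e1 * e2 * e3) / of_int e2 ^ 3"
    unfolding d by (simp add: power_divide power_mult_distrib delta3 e(2))
  also have "\<dots> = of_int e3 * of_int e1 ^ 2 * \<epsilon>"
    using p by (simp add: field_simps power2_eq_square power3_eq_cube)
  finally have "\<exists>\<epsilon>\<in>Up. (\<gamma> * \<delta> / of_int e2) ^ 3 = of_int e3 * of_int e1 ^ 2 * \<epsilon>" using e(1) by blast
  moreover have "\<gamma> * \<delta> / of_int e2 \<in> L" using g(1) L_delta by (simp add: L_closed(4,8,10))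
  moreover have "e3 * e1 * e2 = d" using d by (simp add: ac_simps)
  ultimately show ?thesis using p g delta_gt by (simp add: ambiguous_gen_def)
qed

text \<open>Squaring e1 e2^2 and removing the cube e2^3 leaves e2 e1^2, so passing from \<alpha> to
  \<alpha>^2 exchanges the first two divisors.\<close>

lemma ambiguous_gen_square:
  assumes "ambiguous_gen \<gamma> e1 e2 e3"
  shows "ambiguous_gen (\<gamma> ^ 2 / of_int e2) e2 e1 e3"
proof -
  obtain \<epsilon> where e: "\<epsilon> \<in> Up" "\<gamma> ^ 3 = of_int e1 * of_int e2 ^ 2 * \<epsilon>" and g: "\<gamma> \<in> L" "\<gamma> > 0"
    and p: "e1 > 0" "e2 > 0" "e3 > 0" and d: "e1 * e2 * e3 = d"
    using assms by (auto simp: ambiguous_gen_def)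
  have "(\<gamma> ^ 2 / of_int e2) ^ 3 = (\<gamma> ^ 3) ^ 2 / of_int e2 ^ 3"
    by (simp add: power_divide flip: power_mult)
  also have "\<dots> = of_int e2 * of_int e1 ^ 2 * \<epsilon> ^ 2"
    unfolding e(2) using p by (simp add: field_simps power2_eq_square power3_eq_cube)
  finally have "\<exists>\<epsilon>\<in>Up. (\<gamma> ^ 2 / of_int e2) ^ 3 = of_int e2 * of_int e1 ^ 2 * \<epsilon>"
    using Up_power[OF e(1)] by blast
  moreover have "\<gamma> ^ 2 / of_int e2 \<in> L" using g(1) by (simp add: L_closed(8,9,10))
  moreover have "e2 * e1 * e3 = d" using d by (simp add: ac_simps)
  ultimately show ?thesis using p g by (simp add: ambiguous_gen_def)
qed

lemma ambiguous_gen_one: "ambiguous_gen 1 1 1 d"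
  using d_gt Up_one L_closed(1) by (auto simp: ambiguous_gen_def)

text \<open>\<open>R\<close> is an integer because \<open>e\<^sub>1 e\<^sub>2\<^sup>2\<close> is cube-free, and \<open>R > 1\<close> is impossible because \<open>\<gamma> \<eta>\<close> would then
  beat \<open>R \<gamma> \<eta>\<close>.\<close>

lemma ambiguous_gen_Minima_primitive:
  assumes g: "ambiguous_gen \<gamma> e1 e2 e3" and R: "R \<in> \<rat>" "R > 0" and h: "\<eta> \<in> Up" and m: "R * \<gamma> * \<eta> \<in> Minima"
  shows "R = 1 \<and> \<gamma> \<in> Minima"
proof -
  have gL: "\<gamma> \<in> L" and g0: "\<gamma> > 0" and d: "e1 * e2 * e3 = d" using g by (auto simp: ambiguous_gen_def)
  have hL: "\<eta> \<in> L" "\<eta> > 0" using h Up_L Up_pos by auto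
  have RL: "R \<in> L" using R(1) L_closed(11) by blast
  have "nrm (R * \<gamma> * \<eta>) = R ^ 3 * (of_int e1 * of_int e2 ^ 2)"
    using gL hL RL R(1) by (simp add: nrm_mult L_closed(4) nrm_Rats ambiguous_gen_nrm[OF g] Up_nrm[OF h])
  then have "R ^ 3 * (of_int e1 * of_int e2 ^ 2) \<in> \<int>"
    using nrm_int m unfolding Minima_iff by metis
  moreover have "squarefree (e1 * e2)"
    using sqf d by (metis dvd_triv_left squarefree_mono)
  ultimately have "R \<in> \<int>" using cubefree_rational R(1) by blast
  then obtain k where k: "R = of_int k" by (rule Ints_cases)
  have "R \<le> 1"
  proof (rule ccontr)
    assume "\<not> R \<le> 1"
    then have R1: "1 < R" by simp
    have "\<gamma> * \<eta> \<in> int_L \<delta>" using ambiguous_gen_int_L[OF g] Up_int_L[OF h] by (rule int_L_mult)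
    moreover have "\<gamma> * \<eta> \<noteq> 0" using g0 hL by simp
    moreover have "\<bar>\<gamma> * \<eta>\<bar> < R * \<gamma> * \<eta>" using g0 hL R1 by (simp add: mult.assoc)
    moreover have "cmod (cj (\<gamma> * \<eta>)) < cmod (cj (R * \<gamma> * \<eta>))"
    proof -
      have "cmod (cj (\<gamma> * \<eta>)) > 0"
        using cj_eq_0_iff[of "\<gamma> * \<eta>"] gL hL g0 by (simp add: L_closed(4))
      moreover have "cmod (cj (R * \<gamma> * \<eta>)) = R * cmod (cj (\<gamma> * \<eta>))"
        using gL hL RL R by (simp add: mult.assoc cj_mult[of R] L_closed(4) cj_Rats norm_mult)
      ultimately show ?thesis using R1 by simp
    qed
    ultimately show False using not_MinimaI m by blast
  qed
  then have "k = 1" using R(2) unfolding k by simp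
  then have "R = 1" using k by simp
  then show ?thesis using Minima_unit_cancel[OF _ h, of \<gamma>] m by simp
qed

section \<open>Comparing generators that differ by powers of \<delta>\<close>

lemma delta_less: "k ^ 3 < d \<Longrightarrow> of_int k < \<delta>"
proof (rule power_less_imp_less_base[of _ 3])
  assume "k ^ 3 < d"
  then show "real_of_int k ^ 3 < \<delta> ^ 3" unfolding delta3 by (metis of_int_less_iff of_int_power)
qed (use delta_gt in simp)

lemma cmod_zeta: "cmod \<zeta> = 1"
  using power_eq_imp_eq_base[of "norm \<zeta>" 3 1] zeta3 norm_power[of \<zeta> 3] by simp

lemma cmod_cj_rat_delta:
  assumes "r \<in> \<rat>" "r > 0"
  shows "cmod (cj (r * \<delta> ^ j)) = r * \<delta> ^ j"
  using assms delta_gt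
  by (simp add: cj_mult L_closed(9,11) L_delta cj_Rats cj_power cj_delta norm_mult norm_power cmod_zeta)

text \<open>Since |\<delta>'| = \<delta>, a factor r \<delta>^j scales a number and the modulus of
  its conjugate alike; if it exceeds 1, x beats the product.\<close>

lemma not_Minima_scaled:
  assumes x: "x \<in> int_L \<delta>" "x > 0" and r: "r \<in> \<rat>" "1 < r * \<delta> ^ j"
  shows "x * (r * \<delta> ^ j) \<notin> Minima"
proof (rule not_MinimaI[OF x(1)])
  have rp: "r > 0"
    using r(2) delta_gt zero_less_mult_iff[of r "\<delta> ^ j"] by (smt (verit) zero_less_power)
  have xL: "x \<in> L" using x(1) by (rule int_L_in_L)
  show "x \<noteq> 0" using x(2) by simp
  show "\<bar>x\<bar> < x * (r * \<delta> ^ j)" using x(2) r(2) by simp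
  have rL: "r * \<delta> ^ j \<in> L" using r(1) L_delta by (simp add: L_closed(4,9,11))
  have "cmod (cj (x * (r * \<delta> ^ j))) = cmod (cj x) * (r * \<delta> ^ j)"
    unfolding cj_mult[OF xL rL] norm_mult cmod_cj_rat_delta[OF r(1) rp] ..
  moreover have "cmod (cj x) > 0" using cj_eq_0_iff[OF xL] x(2) by simp
  ultimately show "cmod (cj x) < cmod (cj (x * (r * \<delta> ^ j)))" using r(2) by simp
qed

text \<open>The two inequalities say e2^3 < d and (e1 e2)^3 < d^2, that is \<delta>/e2 > 1 and
  \<delta>^2/(e1 e2) > 1. So \<gamma> beats both of its rotations, and only exponents j divisible by
  3 survive.\<close>

lemma ambiguous_gen_Minima_class:
  assumes g: "ambiguous_gen \<gamma> e1 e2 e3" and ineq: "e2 ^ 2 < e1 * e3" "e1 * e2 < e3 ^ 2"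
    and r: "r \<in> \<rat>" "r > 0" and h: "\<eta> \<in> Up" and m: "r * \<delta> ^ j * \<gamma> * \<eta> \<in> Minima"
  shows "r * \<delta> ^ j = 1 \<and> \<gamma> \<in> Minima"
proof -
  have p: "e1 > 0" "e2 > 0" "e3 > 0" and d: "d = e1 * e2 * e3" and g0: "\<gamma> > 0" using g by (auto simp: ambiguous_gen_def)
  define k l where "k = j div 3" and "l = j mod 3"
  have "\<delta> ^ j = (\<delta> ^ 3) ^ k * \<delta> ^ l"
    unfolding k_def l_def power_mult[symmetric] power_add[symmetric] by simp
  then have dj: "\<delta> ^ j = of_int d ^ k * \<delta> ^ l" unfolding delta3 .
  define r' where "r' = r * of_int d ^ k"
  have r': "r' \<in> \<rat>" "r' > 0" using r d_gt by (simp_all add: r'_def)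
  have rj: "r * \<delta> ^ j = r' * \<delta> ^ l" by (simp add: dj r'_def)
  have gi: "\<gamma> \<in> int_L \<delta>" using ambiguous_gen_int_L[OF g] .
  have g1: "ambiguous_gen (\<gamma> * \<delta> / of_int e2) e3 e1 e2" by (rule ambiguous_gen_rotate[OF g])
  have g2: "ambiguous_gen (\<gamma> * \<delta> / of_int e2 * \<delta> / of_int e1) e2 e3 e1" by (rule ambiguous_gen_rotate[OF g1])
  have "l < 3" by (simp add: l_def)
  then consider "l = 0" | "l = 1" | "l = 2" by linarith
  then show ?thesis
  proof cases
    case 1
    then show ?thesis using ambiguous_gen_Minima_primitive[OF g r' h] m unfolding rj by simp
  next
    case 2
    have "r' * \<delta> ^ l * \<gamma> * \<eta> = (r' * of_int e2) * (\<gamma> * \<delta> / of_int e2) * \<eta>"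
      using p by (simp add: 2)
    then have "(r' * of_int e2) * (\<gamma> * \<delta> / of_int e2) * \<eta> \<in> Minima" using m unfolding rj by (simp only:)
    then have "\<gamma> * \<delta> / of_int e2 \<in> Minima"
      using ambiguous_gen_Minima_primitive[OF g1 _ _ h, of "r' * of_int e2"] r' p by (simp only: Rats_mult Rats_of_int mult_pos_pos of_int_0_less_iff)
    moreover have "e2 ^ 3 < d"
      using mult_strict_left_mono[OF ineq(1) p(2)] by (simp add: d power2_eq_square power3_eq_cube ac_simps)
    then have "1 < 1 / of_int e2 * \<delta> ^ 1" using delta_less p by (simp add: field_simps)
    ultimately show ?thesis
      using not_Minima_scaled[OF gi g0, of "1 / of_int e2" 1] by simp
  next
    case 3
    have "r' * \<delta> ^ l * \<gamma> * \<eta> = (r' * of_int e1 * of_int e2) * (\<gamma> * \<delta> / of_int e2 * \<delta> / of_int e1) * \<eta>"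
      using p by (simp add: 3 power2_eq_square)
    then have "(r' * of_int e1 * of_int e2) * (\<gamma> * \<delta> / of_int e2 * \<delta> / of_int e1) * \<eta> \<in> Minima"
      using m unfolding rj by (simp only:)
    then have "\<gamma> * \<delta> / of_int e2 * \<delta> / of_int e1 \<in> Minima"
      using ambiguous_gen_Minima_primitive[OF g2 _ _ h, of "r' * of_int e1 * of_int e2"] r' p
      by (simp only: Rats_mult Rats_of_int mult_pos_pos of_int_0_less_iff)
    moreover have "1 < 1 / of_int (e1 * e2) * \<delta> ^ 2"
    proof -
      have "(e1 * e2) ^ 2 * (e1 * e2) < (e1 * e2) ^ 2 * e3 ^ 2"
        using p ineq(2) by (intro mult_strict_left_mono) auto
      then have "(e1 * e2) ^ 3 < d ^ 2"
        by (simp add: d power2_eq_square power3_eq_cube ac_simps)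
      then have "real_of_int (e1 * e2) ^ 3 < (\<delta> ^ 2) ^ 3"
        unfolding power_mult[symmetric] mult.commute[of 2 3] unfolding power_mult delta3
        by (metis of_int_less_iff of_int_power)
      then have "real_of_int (e1 * e2) < \<delta> ^ 2"
        by (rule power_less_imp_less_base) simp
      then show ?thesis using p by (simp add: field_simps)
    qed
    ultimately show ?thesis
      using not_Minima_scaled[OF gi g0, of "1 / of_int (e1 * e2)" 2] by (simp add: power2_eq_square field_simps)
  qed
qed

text \<open>Taking norms would make e1 e2^2 a rational cube times 1, d or d^2. After cancellation
  one of the cube-free numbers e1 e2^2, e2 e3^2, e1 e3^2 would be a cube, hence 1.\<close>

lemma ambiguous_gen_not_rational_delta:
  assumes g: "ambiguous_gen \<gamma> e1 e2 e3" and ineq: "e2 ^ 2 < e1 * e3" "e1 * e2 < e3 ^ 2" "1 < e1 * e2"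
    and r: "r \<in> \<rat>" and h: "\<eta> \<in> units_L \<delta>"
  shows "\<gamma> \<noteq> r * \<delta> ^ j * \<eta>"
proof
  assume eq: "\<gamma> = r * \<delta> ^ j * \<eta>"
  have p: "e1 > 0" "e2 > 0" "e3 > 0" and d: "d = e1 * e2 * e3" using g by (auto simp: ambiguous_gen_def)
  have hL: "\<eta> \<in> L" using h by (auto simp: units_L_def int_L_def)
  define k l where "k = j div 3" and "l = j mod 3"
  have j: "j = 3 * k + l" by (simp add: k_def l_def)
  \<comment> \<open>The norm of a unit is 1 or -1, hence its own cube, and can be absorbed into the
    cube of \<open>x\<close>.\<close>
  define x where "x = r * of_int d ^ k * nrm \<eta>"
  have n1: "nrm \<eta> ^ 3 = nrm \<eta>" "nrm \<eta> \<in> \<rat>" using units_L_nrm[OF h] by auto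
  have x: "x \<in> \<rat>" using r n1(2) by (simp add: x_def)
  have "nrm \<gamma> = r ^ 3 * of_int d ^ j * nrm \<eta>"
    unfolding eq using r hL by (simp add: nrm_mult nrm_power nrm_Rats nrm_delta L_closed(4,9,11) L_delta)
  also have "\<dots> = x ^ 3 * of_int d ^ l"
    using n1(1) by (simp add: x_def j power_add power_mult_distrib mult.commute[of 3 k] flip: power_mult)
  finally have x3: "x ^ 3 * of_int d ^ l = of_int e1 * of_int e2 ^ 2" using ambiguous_gen_nrm[OF g] by simp
  then have x0: "x \<noteq> 0" using p by auto
  have sq: "squarefree (a * b)" if "a * b dvd d" for a b
    using sqf that squarefree_mono by blast
  have unit: False if y: "y \<in> \<rat>" "y ^ 3 * (of_int a * of_int b ^ 2) = 1" and ab: "a * b dvd d" "a > 0" "b > 0" "a * b > 1"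
    for y :: real and a b :: int
  proof -
    have "y \<in> \<int>" using cubefree_rational[OF sq[OF ab(1)] y(1)] y(2) by simp
    then obtain m where "y = of_int m" by (rule Ints_cases)
    then have "m ^ 3 * (a * b ^ 2) = 1" using y(2) by (metis of_int_eq_1_iff of_int_mult of_int_power)
    then have "a * b ^ 2 dvd 1" by (metis dvd_triv_right)
    moreover have "a dvd a * b ^ 2" "b dvd a * b ^ 2" by (simp_all add: power2_eq_square)
    ultimately have "a dvd 1" "b dvd 1" using dvd_trans by blast+
    then show False using ab by simp
  qed
  have "l < 3" by (simp add: l_def)
  then consider "l = 0" | "l = 1" | "l = 2" by linarith
  then show False
  proof cases
    case 1
    have "inverse x ^ 3 * (of_int e1 * of_int e2 ^ 2) = 1"
      using x3 x0 1 p by (simp add: field_simps)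
    then show False using unit[of "inverse x" e1 e2] x p ineq(3) d by simp
  next
    case 2
    have "x ^ 3 * of_int e3 = of_int e2"
      using x3 p unfolding 2 d by (simp add: power2_eq_square)
    then have "(inverse x * inverse (of_int e3)) ^ 3 * (of_int e2 * of_int e3 ^ 2) = 1"
      using x0 p by (simp add: field_simps power2_eq_square power3_eq_cube)
    moreover have "e2 * e3 > 1"
    proof (rule ccontr)
      assume "\<not> e2 * e3 > 1"
      then have "e2 * e3 = 1" using p mult_pos_pos[of e2 e3] by linarith
      then have "e2 = 1" "e3 = 1" using p zmult_eq_1_iff[of e2 e3] by auto
      then show False using ineq(2) p(1) by simp
    qed
    ultimately show False
      using unit[of "inverse x * inverse (of_int e3)" e2 e3] x p d by simp
  next
    case 3
    have "x ^ 3 * (of_int e1 * of_int e3 ^ 2) = 1"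
      using x3 p unfolding 3 d by (simp add: power2_eq_square ac_simps)
    moreover have "e1 * e3 > 1"
    proof -
      have "0 < e2 ^ 2" using p by simp
      then show ?thesis using ineq(1) by linarith
    qed
    ultimately show False using unit[of x e1 e3] x p d by simp
  qed
qed

end

section \<open>Small elements of ambiguous ideals\<close>

lemma mod3_square: "\<not> 3 dvd x \<Longrightarrow> [x * x = 1] (mod 3)" for x :: int
proof -
  assume "\<not> 3 dvd x"
  then have "x mod 3 = 1 \<or> x mod 3 = 2" by presburger
  then show ?thesis unfolding cong_def by (subst mod_mult_eq[symmetric]) auto
qed

text \<open>Modulo 3 a number prime to 3 is its own inverse. This turns congruences between divisors
  into the signs s and t.\<close>

lemma mod3_mult:
  fixes x y :: int
  assumes "\<not> 3 dvd y"
  shows "[x = y] (mod 3) \<Longrightarrow> [1 = x * y] (mod 3)" "[x = - y] (mod 3) \<Longrightarrow> [- 1 = x * y] (mod 3)"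
proof -
  have sq: "[1 = y * y] (mod 3)" using mod3_square[OF assms] by (rule cong_sym)
  show "[1 = x * y] (mod 3)" if "[x = y] (mod 3)"
    using cong_trans[OF sq cong_sym[OF cong_scalar_right[OF that]]] .
  show "[- 1 = x * y] (mod 3)" if h: "[x = - y] (mod 3)"
  proof -
    have "[- 1 = - (y * y)] (mod 3)" using sq by (simp add: cong_minus_minus_iff)
    then show ?thesis using cong_sym[OF cong_scalar_right[OF h, of y]] by (metis cong_trans mult_minus_left)
  qed
qed

text \<open>These inequalities say that \<open>(1 + s p + t q) / 3\<close> is non-zero and that it and its conjugates have
  absolute value below 1. The numerical bounds on \<open>p, q\<close> below come from
  \<open>2\<^sup>1\<^sup>/\<^sup>2 < 1.415\<close>, \<open>6\<^sup>1\<^sup>/\<^sup>4 < 1.566\<close> and \<open>24\<^sup>1\<^sup>/\<^sup>6 < 1.7\<close>.\<close>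

definition competitor_bound :: "int \<Rightarrow> int \<Rightarrow> real \<Rightarrow> real \<Rightarrow> bool" where
  "competitor_bound s t p q \<longleftrightarrow> 1 + s * p + t * q \<noteq> 0 \<and> \<bar>1 + s * p + t * q\<bar> < 3 \<and>
     (s * p)\<^sup>2 + (t * q)\<^sup>2 - s * p - t * q - (s * p) * (t * q) < 8"

lemma competitor_bound_sym: "competitor_bound s t p q \<longleftrightarrow> competitor_bound t s q p"
  unfolding competitor_bound_def by (simp add: algebra_simps)

text \<open>The worst sum is about 7.6, for the signs (1, -1). In each mixed pattern the variable
  with sign +1 enters as x^2 - x, which increases for x > 1 and is bounded at the end of its
  range.\<close>

lemma competitor_boundI:
  fixes p q :: real
  assumes "1 < p" "1 < q" "q < 1.7"
  shows "p < 1.415 \<Longrightarrow> competitor_bound (-1) 1 p q" "p < 1.415 \<Longrightarrow> competitor_bound 1 (-1) p q" "p < 1.566 \<Longrightarrow> competitor_bound (-1) (-1) p q"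
proof -
  show "competitor_bound (-1) 1 p q" if p: "p < 1.415"
  proof -
    have m1: "p * p < 1.415 * 1.415" by (rule mult_strict_mono) (use assms p in simp_all)
    have m2: "p * q < 1.415 * 1.7" by (rule mult_strict_mono) (use assms p in simp_all)
    have "(1.7 - q) * (q + 0.7) > 0" using assms by simp
    then have "q * q - q < 1.19" by (simp add: algebra_simps)
    then show "competitor_bound (-1) 1 p q" using m1 m2 assms p unfolding competitor_bound_def by (simp add: power2_eq_square)
  qed
  show "competitor_bound 1 (-1) p q" if p: "p < 1.415"
  proof -
    have m1: "q * q < 1.7 * 1.7" by (rule mult_strict_mono) (use assms p in simp_all)
    have m2: "p * q < 1.415 * 1.7" by (rule mult_strict_mono) (use assms p in simp_all)
    have "(1.415 - p) * (p + 0.415) > 0" using assms p by simp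
    then have "p * p - p < 0.588" by (simp add: algebra_simps)
    then show "competitor_bound 1 (-1) p q" using m1 m2 assms p unfolding competitor_bound_def by (simp add: power2_eq_square)
  qed
  show "competitor_bound (-1) (-1) p q" if p: "p < 1.566"
  proof -
    have m1: "p * p < 1.566 * 1.566" by (rule mult_strict_mono) (use assms p in simp_all)
    have m2: "q * q < 1.7 * 1.7" by (rule mult_strict_mono) (use assms p in simp_all)
    \<comment> \<open>Here the product of the signs is positive, so - p q partly cancels p + q,
      which leaves room for the weaker bound on \<open>p\<close>.\<close>
    have "(p - 1) * (q - 1) > 0" using assms by simp
    then have "p + q - p * q < 1" by (simp add: algebra_simps)
    then show "competitor_bound (-1) (-1) p q" using m1 m2 assms p unfolding competitor_bound_def by (simp add: power2_eq_square)
  qed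
qed

lemma sqrt6_less: "sqrt 6 < 2.4495"
  by (rule real_less_lsqrt) (simp_all add: power2_eq_square)

text \<open>The margins are 1.415^2 > 2, 1.566^2 > 2.4495 and 1.7^3 = 4.913 > 2 * 2.4495. One
  variable is bounded through its square and the other through its cube; the roles are exchanged
  between the two cases of the theorem.\<close>

lemma ratio_bounds:
  fixes p q x y z :: real
  assumes "0 < q" "p\<^sup>2 < x" "q ^ 3 \<le> y * z" "0 < y" "0 < z"
  shows "x \<le> 2 \<Longrightarrow> p < 1.415" "x \<le> sqrt 6 \<Longrightarrow> p < 1.566"
    "y \<le> 2 \<and> z \<le> sqrt 6 \<or> y \<le> sqrt 6 \<and> z \<le> 2 \<or> y \<le> 2 \<and> z \<le> 2 \<Longrightarrow> q < 1.7"
proof -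
  show "p < 1.415" if "x \<le> 2"
  proof (rule power_less_imp_less_base[of _ 2])
    show "p\<^sup>2 < 1.415\<^sup>2" using assms(2) that by (simp add: power2_eq_square)
  qed simp
  show "p < 1.566" if "x \<le> sqrt 6"
  proof (rule power_less_imp_less_base[of _ 2])
    show "p\<^sup>2 < 1.566\<^sup>2" using assms(2) that sqrt6_less by (simp add: power2_eq_square)
  qed simp
  show "q < 1.7" if yz: "y \<le> 2 \<and> z \<le> sqrt 6 \<or> y \<le> sqrt 6 \<and> z \<le> 2 \<or> y \<le> 2 \<and> z \<le> 2"
  proof (rule power_less_imp_less_base[of _ 3])
    have "y * z \<le> 2 * 2.4495"
      using yz sqrt6_less mult_mono[of y 2 z "2.4495"] mult_mono[of y "2.4495" z 2] assms(4,5) by auto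
    then show "q ^ 3 < 1.7 ^ 3" using assms(3) by (simp add: power3_eq_cube)
  qed simp
qed

text \<open>The square estimates come from p^6 = a^2 c^2 / b^4 and q^6 = c^4 / (a^2 b^2): the order
  of a^2 and b c decides which variable gets one.\<close>

lemma ratio_powers:
  fixes a b c p q :: real
  assumes pos: "0 < a" "0 < b" "0 < c" "0 < p" "0 < q"
    and p: "p ^ 3 = a * c / b\<^sup>2" and q: "q ^ 3 = c\<^sup>2 / (a * b)"
    and less: "b\<^sup>2 < a * c" "a * b < c\<^sup>2"
  shows "1 < p" "1 < q" "a\<^sup>2 < b * c \<Longrightarrow> p\<^sup>2 < c / b" "b * c < a\<^sup>2 \<Longrightarrow> q\<^sup>2 < c / b"
    "p ^ 3 = (a / b) * (c / b)" "q ^ 3 = (c / a) * (c / b)"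
proof -
  show p3: "p ^ 3 = (a / b) * (c / b)" and q3: "q ^ 3 = (c / a) * (c / b)"
    unfolding p q by (simp_all add: power2_eq_square)
  have "1 ^ 3 < p ^ 3" unfolding p using pos less by (simp add: field_simps)
  then show "1 < p" by (rule power_less_imp_less_base) (use pos in simp)
  have "1 ^ 3 < q ^ 3" unfolding q using pos less by (simp add: field_simps)
  then show "1 < q" by (rule power_less_imp_less_base) (use pos in simp)
  show "p\<^sup>2 < c / b" if h: "a\<^sup>2 < b * c"
  proof (rule power_less_imp_less_base[of _ 3])
    have "(p\<^sup>2) ^ 3 = (p ^ 3)\<^sup>2" by (simp flip: power_mult)
    also have "\<dots> = a\<^sup>2 * (c\<^sup>2 / b ^ 4)"
      unfolding p by (simp add: power_divide power_mult_distrib flip: power_mult)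
    also have "\<dots> < (b * c) * (c\<^sup>2 / b ^ 4)"
      using h pos by (intro mult_strict_right_mono) auto
    also have "\<dots> = (c / b) ^ 3"
      using pos by (simp add: field_simps power2_eq_square power3_eq_cube power4_eq_xxxx)
    finally show "(p\<^sup>2) ^ 3 < (c / b) ^ 3" .
  qed (use pos in simp)
  show "q\<^sup>2 < c / b" if h: "b * c < a\<^sup>2"
  proof (rule power_less_imp_less_base[of _ 3])
    have "(q\<^sup>2) ^ 3 = (q ^ 3)\<^sup>2" by (simp flip: power_mult)
    also have "\<dots> = c ^ 4 / (a\<^sup>2 * b\<^sup>2)"
      unfolding q by (simp add: power_divide power_mult_distrib flip: power_mult)
    also have "\<dots> < c ^ 4 / ((b * c) * b\<^sup>2)"
      using h pos by (intro divide_strict_left_mono mult_strict_right_mono) auto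
    also have "\<dots> = (c / b) ^ 3"
      using pos by (simp add: field_simps power2_eq_square power3_eq_cube power4_eq_xxxx)
    finally show "(q\<^sup>2) ^ 3 < (c / b) ^ 3" .
  qed (use pos in simp)
qed

section \<open>Integral competitors when d is 1 or -1 modulo 9\<close>

context pure_cubic
begin

text \<open>Replacing \<delta> by D = e \<delta> gives D^3 = 9 k + 1, and w = (1 + D + D^2) / 3 is a
  root of X^3 - X^2 - 3 k X - 3 k^2.\<close>

lemma omega_int_L:
  fixes e :: int
  assumes "e = 1 \<or> e = -1" "[d = e] (mod 9)"
  shows "(1 + of_int e * \<delta> + \<delta>\<^sup>2) / 3 \<in> int_L \<delta>"
proof -
  obtain k' where "d - e = 9 * k'" using assms(2) by (auto simp: cong_iff_dvd_diff)
  then have "e * d = 9 * (e * k') + 1" using assms(1) by auto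
  then obtain k where k: "e * d = 9 * k + 1" by blast
  define D where "D = of_int e * \<delta>"
  have e2: "e * e = 1" using assms(1) by auto
  have "D ^ 3 = of_int (e * e * (e * d))"
    by (simp add: D_def power_mult_distrib delta3 power3_eq_cube[of "of_int e"])
  then have D3: "D ^ 3 = 9 * of_int k + 1" unfolding e2 k by simp
  have D2: "D\<^sup>2 = \<delta>\<^sup>2" using assms(1) by (auto simp: D_def)
  define w where "w = (1 + D + D\<^sup>2) / 3"
  have k9: "9 * of_int k = D ^ 3 - 1" and w3: "3 * w = 1 + D + D\<^sup>2" using D3 by (simp_all add: w_def)
  \<comment> \<open>Clearing denominators turns the equation into an identity in 3 w and 9 k, both
    polynomials in D.\<close>
  have "27 * (w ^ 3 - w\<^sup>2 - 3 * of_int k * w - 3 * (of_int k)\<^sup>2) =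
      (3 * w) ^ 3 - 3 * (3 * w)\<^sup>2 - 3 * (9 * of_int k) * (3 * w) - (9 * of_int k)\<^sup>2"
    by (simp add: algebra_simps power2_eq_square power3_eq_cube)
  also have "\<dots> = 0"
    unfolding k9 w3 by (simp add: algebra_simps power2_eq_square power3_eq_cube)
  finally have "w ^ 3 - w\<^sup>2 - 3 * of_int k * w - 3 * (of_int k)\<^sup>2 = 0" by simp
  then have "poly [:- 3 * (of_int k)\<^sup>2, - 3 * of_int k, - 1, 1:] w = 0"
    by (simp add: algebra_simps power2_eq_square power3_eq_cube)
  moreover have "\<forall>i. coeff [:- 3 * (of_int k)\<^sup>2, - 3 * of_int k, - 1, 1 :: real:] i \<in> \<int>"
    by (auto simp: coeff_pCons split: nat.splits)
  ultimately have "algebraic_int w"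
    by (intro algebraic_int.intros) auto
  moreover have "w \<in> L"
    unfolding w_def D_def using L_closed(11)[of 3] L_delta by (simp add: L_closed(1,3,4,8,9,10))
  ultimately show ?thesis by (simp add: int_L_def w_def D_def[symmetric] D2)
qed

text \<open>The competitor \<open>\<gamma> (1 + s p + t q) / 3\<close>: away from 3 it is integral because its triple is, at 3
  because \<open>\<gamma>\<close> is multiplied by an integral element up to the unit \<open>e\<^sub>1 e\<^sub>2\<close>.\<close>

lemma ambiguous_gen_not_Minima:
  fixes s t :: int
  assumes g: "ambiguous_gen \<gamma> e1 e2 e3" and d9: "[d = 1] (mod 9) \<or> [d = -1] (mod 9)"
    and st: "s = 1 \<or> s = -1" "t = 1 \<or> t = -1" "[s = e1 * e3] (mod 3)" "[t = e1 * e2] (mod 3)"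
    and small: "competitor_bound s t (\<delta> / of_int e2) (\<delta>\<^sup>2 / of_int (e1 * e2))"
  shows "\<gamma> \<notin> Minima"
proof -
  have p: "e1 > 0" "e2 > 0" "e3 > 0" and d: "d = e1 * e2 * e3" and g0: "\<gamma> > 0" and gL: "\<gamma> \<in> L"
    using g by (auto simp: ambiguous_gen_def)
  define m where "m = e1 * e2"
  have m0: "m > 0" using p by (simp add: m_def)
  define \<phi> where "\<phi> = span3 (1 / 3) (real_of_int s / (3 * real_of_int e2)) (real_of_int t / (3 * real_of_int m))"
  define \<theta> where "\<theta> = \<gamma> * \<phi>"
  define P Q where "P = real_of_int s * (\<delta> / real_of_int e2)" and "Q = real_of_int t * (\<delta>\<^sup>2 / real_of_int m)"
  have phi: "\<phi> = (1 + P + Q) / 3"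
    by (simp add: \<phi>_def span3_def P_def Q_def add_divide_distrib)
  have rat: "1 / 3 \<in> (\<rat> :: real set)" "real_of_int s / (3 * real_of_int e2) \<in> \<rat>" "real_of_int t / (3 * real_of_int m) \<in> \<rat>"
    by simp_all
  have phiL: "\<phi> \<in> L" unfolding \<phi>_def using L_iff rat by blast
  have sm: "1 + P + Q \<noteq> 0" "\<bar>1 + P + Q\<bar> < 3" "P\<^sup>2 + Q\<^sup>2 - P - Q - P * Q < 8"
    using small unfolding competitor_bound_def P_def Q_def m_def by blast+
  have PQ: "real_of_int s / (3 * real_of_int e2) * \<delta> = P / 3" "real_of_int t / (3 * real_of_int m) * \<delta>\<^sup>2 = Q / 3"
    by (simp_all add: P_def Q_def)
  have "(cmod (cj \<phi>))\<^sup>2 = ((1 / 3 - P / 3)\<^sup>2 + (P / 3 - Q / 3)\<^sup>2 + (1 / 3 - Q / 3)\<^sup>2) / 2"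
    unfolding \<phi>_def cmod_cj_sq[OF rat] span3_norm_cofactor PQ ..
  also have "\<dots> = (1 + (P\<^sup>2 + Q\<^sup>2 - P - Q - P * Q)) / 9"
    by (simp add: field_simps power2_eq_square)
  \<comment> \<open>The bound 8 in \<open>competitor_bound\<close> is 9 - 1.\<close>
  also have "\<dots> < 1 ^ 2" using sm(3) by simp
  finally have cphi: "cmod (cj \<phi>) < 1" by (rule power_less_imp_less_base) simp
  obtain e :: int where e: "e = 1 \<or> e = -1" "[d = e] (mod 9)" using d9 by blast
  have e3': "[e = m * e3] (mod 3)"
    unfolding m_def d[symmetric] by (rule cong_sym[OF cong_dvd_modulus[OF e(2)]]) simp
  have tm: "[t * m = 1] (mod 3)"
  proof -
    have "[t * m = t * t] (mod 3)" unfolding m_def by (rule cong_scalar_left[OF cong_sym[OF st(4)]])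
    then show ?thesis using st(2) by auto
  qed
  have ne2: "\<not> 3 dvd e2"
  proof
    assume "3 dvd e2"
    then have "3 dvd t * m" by (simp add: m_def)
    then show False using tm by (simp add: cong_def mod_eq_0_iff_dvd)
  qed
  \<comment> \<open>Both s e1 and e m are congruent to e1^2 e3, because e = d = m e3 and e2^2 = 1
    modulo 3.\<close>
  have "[s * e1 = e1 * e3 * e1] (mod 3)" using st(3) by (rule cong_scalar_right)
  moreover have "[e * m = m * e3 * m] (mod 3)" using e3' by (rule cong_scalar_right)
  moreover have "[m * e3 * m = e1 * e3 * e1] (mod 3)"
    using cong_scalar_left[OF mod3_square[OF ne2], of "e1 * e3 * e1"] by (simp add: m_def ac_simps)
  ultimately have "[s * e1 = e * m] (mod 3)" by (metis cong_sym cong_trans)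
  then obtain f where f: "s * e1 - e * m = 3 * f" by (auto simp: cong_iff_dvd_diff)
  obtain h where h: "t - m = 3 * h" using st(4) by (auto simp: cong_iff_dvd_diff m_def)
  obtain w where w: "t * m - 1 = 3 * w" using tm by (auto simp: cong_iff_dvd_diff)
  \<comment> \<open>3 m \<phi> has coordinates (m, s e1, t). Modulo 3 these are m (1, e, 1), so m
    \<phi> is m (1 + e \<delta> + \<delta>^2) / 3 plus integer multiples of \<delta> and
    \<delta>^2.\<close>
  define y where "y = of_int m * ((1 + of_int e * \<delta> + \<delta>\<^sup>2) / 3) + of_int f * \<delta> + of_int h * \<delta>\<^sup>2"
  have y: "y \<in> int_L \<delta>"
    unfolding y_def by (intro int_L_add int_L_mult int_L_of_int omega_int_L[OF e] int_L_delta int_L_power)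
  have "3 * y = of_int m + of_int (e * m + 3 * f) * \<delta> + of_int (m + 3 * h) * \<delta>\<^sup>2"
    by (simp add: y_def algebra_simps)
  also have "\<dots> = of_int m + of_int (s * e1) * \<delta> + of_int t * \<delta>\<^sup>2"
    unfolding f[symmetric] h[symmetric] by simp
  also have "\<dots> = of_int m * (1 + P + Q)"
    using p m0 by (simp add: P_def Q_def m_def field_simps)
  finally have "y = of_int m * \<phi>" by (simp add: phi)
  then have my: "of_int m * \<theta> = \<gamma> * y" by (simp add: \<theta>_def)
  have g1: "ambiguous_gen (\<gamma> * \<delta> / of_int e2) e3 e1 e2" by (rule ambiguous_gen_rotate[OF g])
  have g2: "ambiguous_gen (\<gamma> * \<delta> / of_int e2 * \<delta> / of_int e1) e2 e3 e1" by (rule ambiguous_gen_rotate[OF g1])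
  have th3: "3 * \<theta> = \<gamma> + of_int s * (\<gamma> * \<delta> / of_int e2) + of_int t * (\<gamma> * \<delta> / of_int e2 * \<delta> / of_int e1)"
    by (simp add: \<theta>_def phi P_def Q_def m_def algebra_simps power2_eq_square)
  \<comment> \<open>A Bezout relation between m and 3, with t inverting m modulo 3: integrality of m
    \<theta> and of 3 \<theta> gives that of \<theta>.\<close>
  have "\<theta> = of_int (t * m - 3 * w) * \<theta>" unfolding w[symmetric] by simp
  also have "\<dots> = of_int t * (of_int m * \<theta>) - of_int w * (3 * \<theta>)" by (simp add: algebra_simps)
  also have "\<dots> = of_int t * (\<gamma> * y) + of_int (- w) *
      (\<gamma> + of_int s * (\<gamma> * \<delta> / of_int e2) + of_int t * (\<gamma> * \<delta> / of_int e2 * \<delta> / of_int e1))"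
    unfolding my th3 by simp
  also have "\<dots> \<in> int_L \<delta>"
    by (intro int_L_add int_L_mult int_L_of_int y ambiguous_gen_int_L[OF g] ambiguous_gen_int_L[OF g1] ambiguous_gen_int_L[OF g2])
  finally have thi: "\<theta> \<in> int_L \<delta>" .
  show ?thesis
  proof (rule not_MinimaI[OF thi])
    show "\<theta> \<noteq> 0" using g0 sm(1) by (simp add: \<theta>_def phi)
    have "\<bar>\<phi>\<bar> < 1" using sm(2) by (simp add: phi)
    then show "\<bar>\<theta>\<bar> < \<gamma>" using g0 by (simp add: \<theta>_def abs_mult)
    have "cmod (cj \<gamma>) > 0" using cj_eq_0_iff[OF gL] g0 by simp
    then show "cmod (cj \<theta>) < cmod (cj \<gamma>)"
      using cphi by (simp add: \<theta>_def cj_mult[OF gL phiL] norm_mult)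
  qed
qed

lemma ambiguous_gen_ratio:
  assumes g: "ambiguous_gen \<gamma> e1 e2 e3"
  shows "(\<delta> / of_int e2) ^ 3 = of_int e1 * of_int e3 / (of_int e2)\<^sup>2"
    "(\<delta>\<^sup>2 / of_int (e1 * e2)) ^ 3 = (of_int e3)\<^sup>2 / (of_int e1 * of_int e2)"
proof -
  have p: "e1 > 0" "e2 > 0" "e3 > 0" and d: "d = e1 * e2 * e3" using g by (auto simp: ambiguous_gen_def)
  show "(\<delta> / of_int e2) ^ 3 = of_int e1 * of_int e3 / (of_int e2)\<^sup>2"
    unfolding power_divide delta3 d using p by (simp add: power2_eq_square power3_eq_cube)
  have "(\<delta>\<^sup>2) ^ 3 = (\<delta> ^ 3)\<^sup>2" by (simp flip: power_mult)
  then have d6: "(\<delta>\<^sup>2) ^ 3 = (of_int (e1 * e2 * e3))\<^sup>2" unfolding delta3 d .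
  show "(\<delta>\<^sup>2 / of_int (e1 * e2)) ^ 3 = (of_int e3)\<^sup>2 / (of_int e1 * of_int e2)"
    unfolding power_divide d6 using p by (simp add: power2_eq_square power3_eq_cube)
qed

lemma ambiguous_gen_not_dvd3:
  assumes "[d = 1] (mod 9) \<or> [d = -1] (mod 9)" "ambiguous_gen \<gamma> e1 e2 e3"
  shows "\<not> 3 dvd e1" "\<not> 3 dvd e2" "\<not> 3 dvd e3"
proof -
  have "\<not> 3 dvd d"
    using assms(1) cong_dvd_iff[OF cong_dvd_modulus[of d 1 9 3]] cong_dvd_iff[OF cong_dvd_modulus[of d "- 1" 9 3]] by auto
  moreover have "e1 dvd d" "e2 dvd d" "e3 dvd d" using assms(2) by (auto simp: ambiguous_gen_def)
  ultimately show "\<not> 3 dvd e1" "\<not> 3 dvd e2" "\<not> 3 dvd e3" using dvd_trans by blast+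
qed

text \<open>The inequalities make \<open>e3\<close> the largest divisor. Then p^2 < e3/e2 while q^3
  = (e3/e1)(e3/e2), so bounds on e3 relative to e1 and e2 suffice.\<close>

lemma ambiguous_gen_not_Minima_largest:
  assumes d9: "[d = 1] (mod 9) \<or> [d = -1] (mod 9)" and g: "ambiguous_gen \<gamma> e1 e2 e3"
    and less: "e2\<^sup>2 < e1 * e3" "e1\<^sup>2 < e2 * e3" "e1 * e2 < e3\<^sup>2"
    and crit: "[e1 = e2] (mod 3) \<and> [e1 = - e3] (mod 3) \<and> e3 \<le> 2 * e1 \<and> e3 \<le> 2 * e2 \<or>
       [e1 = - e2] (mod 3) \<and> [e1 = e3] (mod 3) \<and> real_of_int e3 \<le> sqrt 6 * e1 \<and> e3 \<le> 2 * e2 \<or>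
       [e1 = - e2] (mod 3) \<and> [e1 = - e3] (mod 3) \<and> e3 \<le> 2 * e1 \<and> real_of_int e3 \<le> sqrt 6 * e2"
  shows "\<gamma> \<notin> Minima"
proof -
  define p q where "p = \<delta> / of_int e2" and "q = \<delta>\<^sup>2 / of_int (e1 * e2)"
  have pos: "real_of_int e1 > 0" "real_of_int e2 > 0" "real_of_int e3 > 0" using g by (auto simp: ambiguous_gen_def)
  have pq: "0 < p" "0 < q" using pos delta_gt by (simp_all add: p_def q_def)
  have less': "(real_of_int e2)\<^sup>2 < of_int e1 * of_int e3" "(real_of_int e1)\<^sup>2 < of_int e2 * of_int e3"
    "of_int e1 * of_int e2 < (real_of_int e3)\<^sup>2"
    using less by (simp_all only: of_int_mult[symmetric] of_int_power[symmetric] of_int_less_iff)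
  note R = ratio_powers[OF pos pq ambiguous_gen_ratio[OF g, folded p_def q_def] less'(1,3)]
  have p2: "p\<^sup>2 < e3 / e2" using R(3) less'(2) by blast
  have q3: "q ^ 3 \<le> (e3 / e1) * (e3 / e2)" using R(6) by simp
  have Y: "0 < real_of_int e3 / e1" "0 < real_of_int e3 / e2" using pos by simp_all
  note B = ratio_bounds[OF pq(2) p2 q3 Y]
  note S = competitor_boundI[OF R(1,2)]
  have le: "real_of_int e3 / e1 \<le> c \<longleftrightarrow> e3 \<le> c * e1" "real_of_int e3 / e2 \<le> c \<longleftrightarrow> e3 \<le> c * e2" for c :: real
    using pos by (simp_all add: pos_divide_le_eq)
  have le2: "real_of_int e3 \<le> 2 * real_of_int e1 \<longleftrightarrow> e3 \<le> 2 * e1" "real_of_int e3 \<le> 2 * real_of_int e2 \<longleftrightarrow> e3 \<le> 2 * e2" by linarith+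
  note nd = ambiguous_gen_not_dvd3[OF d9 g]
  note M = mod3_mult[OF nd(2), of e1] mod3_mult[OF nd(3), of e1]
  note N = ambiguous_gen_not_Minima[OF g d9, folded p_def q_def]
  from crit show ?thesis
  proof (elim disjE conjE)
    assume h: "[e1 = e2] (mod 3)" "[e1 = - e3] (mod 3)" "e3 \<le> 2 * e1" "e3 \<le> 2 * e2"
    have "q < 1.7" "p < 1.415" using B(3) B(1) h(3,4) unfolding le le2 by blast+
    then have "competitor_bound (-1) 1 p q" using S(1) by blast
    then show ?thesis using N[of "-1" 1] M h by blast
  next
    assume h: "[e1 = - e2] (mod 3)" "[e1 = e3] (mod 3)" "real_of_int e3 \<le> sqrt 6 * e1" "e3 \<le> 2 * e2"
    have "q < 1.7" "p < 1.415" using B(3) B(1) h(3,4) unfolding le le2 by blast+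
    then have "competitor_bound 1 (-1) p q" using S(2) by blast
    then show ?thesis using N[of 1 "-1"] M h by blast
  next
    assume h: "[e1 = - e2] (mod 3)" "[e1 = - e3] (mod 3)" "e3 \<le> 2 * e1" "real_of_int e3 \<le> sqrt 6 * e2"
    have "q < 1.7" "p < 1.566" using B(3) B(2) h(3,4) unfolding le le2 by blast+
    then have "competitor_bound (-1) (-1) p q" using S(3) by blast
    then show ?thesis using N[of "-1" "-1"] M h by blast
  qed
qed

text \<open>Here \<open>e2\<close> is the smallest divisor, q^2 < e3/e2 and p^3 = (e1/e2)(e3/e2):
  the roles of p and q are exchanged.\<close>

lemma ambiguous_gen_not_Minima_smallest:
  assumes d9: "[d = 1] (mod 9) \<or> [d = -1] (mod 9)" and g: "ambiguous_gen \<gamma> e1 e2 e3"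
    and less: "e2\<^sup>2 < e1 * e3" "e2 * e3 < e1\<^sup>2" "e1 * e2 < e3\<^sup>2"
    and crit: "[e1 = e2] (mod 3) \<and> [e1 = - e3] (mod 3) \<and> real_of_int e1 \<le> sqrt 6 * e2 \<and> e3 \<le> 2 * e2 \<or>
       [e1 = - e2] (mod 3) \<and> [e1 = e3] (mod 3) \<and> e1 \<le> 2 * e2 \<and> e3 \<le> 2 * e2 \<or>
       [e1 = - e2] (mod 3) \<and> [e1 = - e3] (mod 3) \<and> e1 \<le> 2 * e2 \<and> real_of_int e3 \<le> sqrt 6 * e2"
  shows "\<gamma> \<notin> Minima"
proof -
  define p q where "p = \<delta> / of_int e2" and "q = \<delta>\<^sup>2 / of_int (e1 * e2)"
  have pos: "real_of_int e1 > 0" "real_of_int e2 > 0" "real_of_int e3 > 0" using g by (auto simp: ambiguous_gen_def)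
  have pq: "0 < p" "0 < q" using pos delta_gt by (simp_all add: p_def q_def)
  have less': "(real_of_int e2)\<^sup>2 < of_int e1 * of_int e3" "of_int e2 * of_int e3 < (real_of_int e1)\<^sup>2"
    "of_int e1 * of_int e2 < (real_of_int e3)\<^sup>2"
    using less by (simp_all only: of_int_mult[symmetric] of_int_power[symmetric] of_int_less_iff)
  note R = ratio_powers[OF pos pq ambiguous_gen_ratio[OF g, folded p_def q_def] less'(1,3)]
  have q2: "q\<^sup>2 < e3 / e2" using R(4) less'(2) by blast
  have p3: "p ^ 3 \<le> (e1 / e2) * (e3 / e2)" using R(5) by simp
  have Y: "0 < real_of_int e1 / e2" "0 < real_of_int e3 / e2" using pos by simp_all
  note B = ratio_bounds[OF pq(1) q2 p3 Y]
  \<comment> \<open>Exchanging p and q also exchanges the signs, so the two mixed patterns trade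
    places.\<close>
  note S = competitor_boundI[OF R(2,1), unfolded competitor_bound_sym[of _ _ q p]]
  have le: "real_of_int e1 / e2 \<le> c \<longleftrightarrow> e1 \<le> c * e2" "real_of_int e3 / e2 \<le> c \<longleftrightarrow> e3 \<le> c * e2" for c :: real
    using pos by (simp_all add: pos_divide_le_eq)
  have le2: "real_of_int e1 \<le> 2 * real_of_int e2 \<longleftrightarrow> e1 \<le> 2 * e2" "real_of_int e3 \<le> 2 * real_of_int e2 \<longleftrightarrow> e3 \<le> 2 * e2" by linarith+
  note nd = ambiguous_gen_not_dvd3[OF d9 g]
  note M = mod3_mult[OF nd(2), of e1] mod3_mult[OF nd(3), of e1]
  note N = ambiguous_gen_not_Minima[OF g d9, folded p_def q_def]
  from crit show ?thesis
  proof (elim disjE conjE)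
    assume h: "[e1 = e2] (mod 3)" "[e1 = - e3] (mod 3)" "real_of_int e1 \<le> sqrt 6 * e2" "e3 \<le> 2 * e2"
    have "p < 1.7" "q < 1.415" using B(3) B(1) h(3,4) unfolding le le2 by blast+
    then have "competitor_bound (-1) 1 p q" using S(2) by blast
    then show ?thesis using N[of "-1" 1] M h by blast
  next
    assume h: "[e1 = - e2] (mod 3)" "[e1 = e3] (mod 3)" "e1 \<le> 2 * e2" "e3 \<le> 2 * e2"
    have "p < 1.7" "q < 1.415" using B(3) B(1) h(3,4) unfolding le le2 by blast+
    then have "competitor_bound 1 (-1) p q" using S(1) by blast
    then show ?thesis using N[of 1 "-1"] M h by blast
  next
    assume h: "[e1 = - e2] (mod 3)" "[e1 = - e3] (mod 3)" "e1 \<le> 2 * e2" "real_of_int e3 \<le> sqrt 6 * e2"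
    have "p < 1.7" "q < 1.566" using B(3) B(2) h(3,4) unfolding le le2 by blast+
    then have "competitor_bound (-1) (-1) p q" using S(3) by blast
    then show ?thesis using N[of "-1" "-1"] M h by blast
  qed
qed


section \<open>Principal factors and a criterion for M0-fields\<close>

lemma m_inv_mult_of_L:
  assumes "x \<in> L" "x \<noteq> 0"
  shows "inv\<^bsub>Multiplicative_Group.mult_of (ring_of_type_algebra\<lparr>carrier := L\<rparr>)\<^esub> x = inverse x"
proof -
  have "inverse x \<in> L" using assms L_closed(6) by blast
  then show ?thesis
    unfolding m_inv_def using assms
    by (intro the_equality) (simp_all add: Multiplicative_Group.mult_of_def, metis inverse_unique)
qed

lemma generate_decompose:
  assumes "x \<in> generate (Multiplicative_Group.mult_of (ring_of_type_algebra\<lparr>carrier := L\<rparr>))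
    (units_L \<delta> \<union> (\<rat> - {0}) \<union> {\<delta>})"
  shows "\<exists>r\<in>\<rat>. \<exists>\<eta>\<in>units_L \<delta>. \<exists>j::nat. x = r * \<delta> ^ j * \<eta>"
  using assms
proof (induction rule: generate.induct)
  have u1: "1 \<in> units_L \<delta>" using Up_one by (simp add: pos_units_L_def)
  {
    case one
    show ?case using u1 by (intro bexI[of _ 1] exI[of _ 0]) (auto simp: Multiplicative_Group.mult_of_def)
  next
    case (incl h)
    then consider "h \<in> units_L \<delta>" | "h \<in> \<rat>" | "h = \<delta>" by blast
    then show ?case
    proof cases
      case 1
      then show ?thesis by (intro bexI[of _ 1] bexI[of _ h] exI[of _ 0]) auto
    next
      case 2
      then show ?thesis using u1 by (intro bexI[of _ h] bexI[of _ 1] exI[of _ 0]) auto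
    next
      case 3
      then show ?thesis using u1 by (intro bexI[of _ 1] exI[of _ 1]) auto
    qed
  next
    case (inv h)
    have hL: "h \<in> L" "h \<noteq> 0"
      using inv L_closed(11) L_delta delta_gt
      by (auto simp: units_L_def int_L_def)
    from inv consider "h \<in> units_L \<delta>" | "h \<in> \<rat>" | "h = \<delta>" by blast
    then have "\<exists>r\<in>\<rat>. \<exists>\<eta>\<in>units_L \<delta>. \<exists>j::nat. inverse h = r * \<delta> ^ j * \<eta>"
    proof cases
      case 1
      then obtain y where y: "h \<in> int_L \<delta>" "y \<in> int_L \<delta>" "h * y = 1" by (auto simp: units_L_def)
      then have "inverse h = y" by (simp add: inverse_unique)
      moreover have "y \<in> units_L \<delta>" unfolding units_L_def using y by (auto intro!: bexI[of _ h] simp: mult.commute)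
      ultimately show ?thesis by (intro bexI[of _ 1] bexI[of _ y] exI[of _ 0]) auto
    next
      case 2
      then show ?thesis using u1 by (intro bexI[of _ "inverse h"] bexI[of _ 1] exI[of _ 0]) auto
    next
      case 3
      \<comment> \<open>The inverse of \<delta> is \<delta>^2 / d, so natural exponents suffice once
        the rational factor absorbs d.\<close>
      have "\<delta> * (1 / of_int d * \<delta> ^ 2) = \<delta> ^ 3 / of_int d" by (simp add: power2_eq_square power3_eq_cube)
      also have "\<dots> = 1" unfolding delta3 using d_gt by simp
      finally have "inverse \<delta> = 1 / of_int d * \<delta> ^ 2 * 1" using inverse_unique by fastforce
      then show ?thesis using u1 3 by (intro bexI[of _ "1 / of_int d"] bexI[of _ 1] exI[of _ 2]) auto
    qed
    then show ?case unfolding m_inv_mult_of_L[OF hL] .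
  next
    case (eng h1 h2)
    then obtain r1 \<eta>1 j1 r2 \<eta>2 j2 where *: "r1 \<in> \<rat>" "\<eta>1 \<in> units_L \<delta>" "h1 = r1 * \<delta> ^ j1 * \<eta>1"
      "r2 \<in> \<rat>" "\<eta>2 \<in> units_L \<delta>" "h2 = r2 * \<delta> ^ j2 * \<eta>2" by blast
    have "\<eta>1 * \<eta>2 \<in> units_L \<delta>"
    proof -
      obtain y1 y2 where y: "y1 \<in> int_L \<delta>" "\<eta>1 * y1 = 1" "y2 \<in> int_L \<delta>" "\<eta>2 * y2 = 1"
        using *(2,5) by (auto simp: units_L_def)
      have "(\<eta>1 * \<eta>2) * (y1 * y2) = (\<eta>1 * y1) * (\<eta>2 * y2)" by (simp only: ac_simps)
      then have "(\<eta>1 * \<eta>2) * (y1 * y2) = 1" using y by simp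
      then show ?thesis
        using *(2,5) y int_L_mult unfolding units_L_def by blast
    qed
    moreover have "h1 * h2 = (r1 * r2) * \<delta> ^ (j1 + j2) * (\<eta>1 * \<eta>2)"
      unfolding *(3,6) by (simp add: power_add)
    ultimately have "\<exists>r\<in>\<rat>. \<exists>\<eta>\<in>units_L \<delta>. \<exists>j::nat. h1 * h2 = r * \<delta> ^ j * \<eta>"
      using Rats_mult[OF *(1,4)] by blast
    then show ?case by (simp add: Multiplicative_Group.mult_of_def)
  }
qed

text \<open>The norm of \<alpha> is \<alpha> |\<alpha>'|^2 and is positive here, which forces
  \<alpha> > 0; its unit is then \<alpha>^3 / N(\<alpha>).\<close>

lemma principal_factor_ambiguous_gen:
  assumes "principal_factor \<delta> \<zeta> \<sigma> \<alpha>" "norm_L \<sigma> \<alpha> = of_int (e1 * e2\<^sup>2)"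
    and "e1 > 0" "e2 > 0" "e3 > 0" "d = e1 * e2 * e3"
  shows "ambiguous_gen \<alpha> e1 e2 e3"
proof -
  have a: "\<alpha> \<in> int_L \<delta>" "\<alpha> \<in> ambiguous_L \<delta> \<zeta> \<sigma>" using assms(1) by (auto simp: principal_factor_def)
  have aL: "\<alpha> \<in> L" using a(1) by (rule int_L_in_L)
  have "complex_of_real (nrm \<alpha>) = of_real (of_int (e1 * e2\<^sup>2))"
    using assms(2) norm_L_nrm[OF aL] by (simp only: of_real_of_int_eq)
  then have n: "nrm \<alpha> = of_int (e1 * e2\<^sup>2)" by (simp only: of_real_eq_iff)
  then have "nrm \<alpha> > 0" using assms(3,4) by simp
  then have a0: "\<alpha> > 0" using nrm_pos_iff[OF aL] by simp
  have "\<alpha> ^ 3 = of_int e1 * of_int e2 ^ 2 * (\<alpha> ^ 3 / nrm \<alpha>)"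
    unfolding n using assms(3,4) by simp
  then show ?thesis
    unfolding ambiguous_gen_def using aL a0 assms(3-6) ambiguous_unit[OF a(2) a0] by blast
qed

text \<open>The representative \<gamma> of the class of \<alpha>^2 is left open: it is \<alpha>^2/d2
  with k = 0 in one case and \<alpha>^2 \<delta>/(d1 d2) with k = 2 in the other.\<close>

lemma M0_fieldI:
  assumes a: "principal_factor \<delta> \<zeta> \<sigma> \<alpha>"
    and g: "ambiguous_gen \<alpha> e1 e2 e3" "e2\<^sup>2 < e1 * e3" "e1 * e2 < e3\<^sup>2" "1 < e1 * e2" "\<alpha> \<notin> Minima"
    and g': "ambiguous_gen \<gamma> f1 f2 f3" "f2\<^sup>2 < f1 * f3" "f1 * f2 < f3\<^sup>2" "\<gamma> \<notin> Minima"
    and sq: "\<alpha>\<^sup>2 = c * \<delta> ^ k * \<gamma>" "c \<in> \<rat>" "c > 0"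
  shows "M0_field \<delta> \<zeta> \<sigma>"
proof -
  have na: "\<alpha> \<noteq> r * \<delta> ^ j * \<eta>" if "r \<in> \<rat>" "\<eta> \<in> units_L \<delta>" for r j \<eta>
    using ambiguous_gen_not_rational_delta[OF g(1-4) that] .
  have amb: "\<alpha> \<in> ambiguous_L \<delta> \<zeta> \<sigma>" using a by (simp add: principal_factor_def)
  have a0: "\<alpha> > 0" using g(1) by (simp add: ambiguous_gen_def)
  have "type_beta \<delta> \<zeta> \<sigma>"
    unfolding type_beta_def using a generate_decompose na by blast
  moreover have "Minima \<inter> ambiguous_L \<delta> \<zeta> \<sigma> = Up"
  proof
    show "Up \<subseteq> Minima \<inter> ambiguous_L \<delta> \<zeta> \<sigma>"
      using Up_subset_Minima Up_subset_ambiguous by blast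
    show "Minima \<inter> ambiguous_L \<delta> \<zeta> \<sigma> \<subseteq> Up"
    proof
      fix \<beta> assume "\<beta> \<in> Minima \<inter> ambiguous_L \<delta> \<zeta> \<sigma>"
      then have b: "\<beta> \<in> Minima" "\<beta> \<in> ambiguous_L \<delta> \<zeta> \<sigma>" by auto
      then have b0: "\<beta> > 0" by (simp add: Minima_iff)
      have na': "\<alpha> \<noteq> r * \<delta> ^ j * \<eta>" if "r \<in> \<rat>" "\<eta> \<in> Up" for r j \<eta>
        using na that by (auto simp: pos_units_L_def)
      obtain i j r \<eta> where ij: "i < (3::nat)" "r \<in> \<rat>" "r > 0" "\<eta> \<in> Up" "\<beta> = r * \<delta> ^ j * \<alpha> ^ i * \<eta>"
        by (rule ambiguous_decompose[OF amb a0 na' b(2) b0])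
      from ij(1) consider "i = 0" | "i = 1" | "i = 2" by linarith
      then show "\<beta> \<in> Up"
      proof cases
        case 1
        then have eq: "\<beta> = r * \<delta> ^ j * 1 * \<eta>" using ij(5) by simp
        \<comment> \<open>The trivial class is handled by the generator 1 with divisors (1, 1, d),
          leaving \<beta> = \<eta>.\<close>
        have "1\<^sup>2 < 1 * d" "1 * 1 < d\<^sup>2" using d_gt one_less_power[of d 2] by simp_all
        then have "r * \<delta> ^ j = 1"
          using ambiguous_gen_Minima_class[OF ambiguous_gen_one _ _ ij(2-4)] b(1) unfolding eq by blast
        then show ?thesis using ij(4) eq by simp
      next
        case 2
        then have eq: "\<beta> = r * \<delta> ^ j * \<alpha> * \<eta>" using ij(5) by simp
        then have "\<alpha> \<in> Minima" using ambiguous_gen_Minima_class[OF g(1-3) ij(2-4)] b(1) by blast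
        then show ?thesis using g(5) by blast
      next
        case 3
        then have "\<beta> = r * \<delta> ^ j * (c * \<delta> ^ k * \<gamma>) * \<eta>" using ij(5) sq(1) by simp
        then have eq: "\<beta> = (r * c) * \<delta> ^ (j + k) * \<gamma> * \<eta>" by (simp add: power_add)
        have "r * c \<in> \<rat>" "r * c > 0" using ij(2,3) sq(2,3) by simp_all
        then have "\<gamma> \<in> Minima" using ambiguous_gen_Minima_class[OF g'(1-3) _ _ ij(4)] b(1) eq by blast
        then show ?thesis using g'(4) by blast
      qed
    qed
  qed
  ultimately show ?thesis by (simp add: M0_field_def)
qed

end

lemma canonical_divisor_pos: "canonical_divisor d n i > 0"
  unfolding canonical_divisor_def by (rule prod_pos) (auto simp: in_prime_factors_iff prime_gt_0_int)

theorem theorem7p1: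
  fixes d n d1 d2 d3 :: int
    and \<delta> \<alpha> :: real
    and \<zeta> :: complex
    and \<sigma> :: "complex \<Rightarrow> complex"
  assumes "d > 1" and "squarefree d"
    and "[d = 1] (mod 9) \<or> [d = - 1] (mod 9)"
    and "\<delta> = root 3 (real_of_int d)"
    and "primitive_cube_root \<zeta>"
    and "is_sigma \<delta> \<zeta> \<sigma>"
    and "principal_factor \<delta> \<zeta> \<sigma> \<alpha>"
    and "norm_L \<sigma> \<alpha> = of_int n"
    and "d1 = canonical_divisor d n 1"
    and "d2 = canonical_divisor d n 2"
    and "d3 = canonical_divisor d n 0"
    and "d = d1 * d2 * d3"
    and "n = d1 * d2 ^ 2"
    and "d2 ^ 2 < d1 * d3"
    and "d1 * d2 < d3 ^ 2"
  shows "(d1 ^ 2 < d2 * d3 \<and>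
          ([d1 = d2] (mod 3) \<and> [d2 = - d3] (mod 3) \<and> d3 \<le> 2 * min d1 d2 \<or>
           [d1 = - d2] (mod 3) \<and> [- d2 = d3] (mod 3) \<and>
             real_of_int d3 \<le> min (sqrt 6 * real_of_int d1) (2 * real_of_int d2) \<or>
           [- d1 = d3] (mod 3) \<and> [d3 = d2] (mod 3) \<and>
             real_of_int d3 \<le> min (2 * real_of_int d1) (sqrt 6 * real_of_int d2))
          \<longrightarrow> M0_field \<delta> \<zeta> \<sigma> \<and>
              \<alpha> \<notin> lattice_minima \<delta> \<sigma> \<and>
              \<alpha> ^ 2 / real_of_int d2 \<notin> lattice_minima \<delta> \<sigma>) \<and>
         (d2 * d3 < d1 ^ 2 \<and>
          ([d1 = d2] (mod 3) \<and> [d2 = - d3] (mod 3) \<and>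
             real_of_int d1 \<le> sqrt 6 * real_of_int d2 \<and> d3 \<le> 2 * d2 \<or>
           [d1 = - d2] (mod 3) \<and> [- d2 = d3] (mod 3) \<and> max d1 d3 \<le> 2 * d2 \<or>
           [- d1 = d3] (mod 3) \<and> [d3 = d2] (mod 3) \<and>
             d1 \<le> 2 * d2 \<and> real_of_int d3 \<le> sqrt 6 * real_of_int d2)
          \<longrightarrow> M0_field \<delta> \<zeta> \<sigma> \<and>
              \<alpha> \<notin> lattice_minima \<delta> \<sigma> \<and>
              (\<alpha> ^ 2 / real_of_int d2) * \<delta> / real_of_int d1 \<notin> lattice_minima \<delta> \<sigma>)"
proof -
  interpret pure_cubic d \<delta> \<zeta> \<sigma>
    using assms(1,2,4-6) by unfold_locales
  note d9 = assms(3)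
  have p: "d1 > 0" "d2 > 0" "d3 > 0"
    unfolding assms(9-11) by (rule canonical_divisor_pos)+
  have g: "ambiguous_gen \<alpha> d1 d2 d3"
    using assms(8) p assms(12) unfolding assms(13) by (intro principal_factor_ambiguous_gen[OF assms(7)])
  have g': "ambiguous_gen (\<alpha>\<^sup>2 / real_of_int d2) d2 d1 d3" by (rule ambiguous_gen_square[OF g])
  have g'': "ambiguous_gen (\<alpha>\<^sup>2 / real_of_int d2 * \<delta> / real_of_int d1) d3 d2 d1" by (rule ambiguous_gen_rotate[OF g'])
  have neg: "[x = - y] (mod 3) \<Longrightarrow> [y = - x] (mod 3)" for x y :: int
    by (simp add: cong_iff_dvd_diff add.commute)
  have cong: "[d2 = d1] (mod 3) \<and> [d1 = - d3] (mod 3) \<and> [d3 = - d1] (mod 3) \<and> [d3 = - d2] (mod 3)"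
    if "[d1 = d2] (mod 3) \<and> [d2 = - d3] (mod 3)"
    using that neg cong_sym[of d1 d2] cong_trans[of d1 d2 3 "- d3"] by simp
  have cong': "[d2 = - d1] (mod 3) \<and> [d1 = d3] (mod 3) \<and> [d3 = d1] (mod 3) \<and> [d2 = - d3] (mod 3) \<and> [d3 = - d2] (mod 3)"
    if h: "[d1 = - d2] (mod 3) \<and> [- d2 = d3] (mod 3)"
  proof -
    have "[d1 = d3] (mod 3)" "[d3 = - d2] (mod 3)" using h cong_trans cong_sym by blast+
    then show ?thesis using h neg cong_sym by blast
  qed
  have cong'': "[d1 = - d2] (mod 3) \<and> [d2 = - d1] (mod 3) \<and> [d1 = - d3] (mod 3) \<and> [d3 = - d1] (mod 3) \<and> [d2 = d3] (mod 3)"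
    if h: "[- d1 = d3] (mod 3) \<and> [d3 = d2] (mod 3)"
  proof -
    have "[d3 = - d1] (mod 3)" "[d2 = d3] (mod 3)" "[d2 = - d1] (mod 3)" using h cong_trans cong_sym by blast+
    then show ?thesis using neg by blast
  qed
  have min: "d3 \<le> 2 * min d1 d2 \<longleftrightarrow> d3 \<le> 2 * d1 \<and> d3 \<le> 2 * d2"
    "real_of_int d3 \<le> min (sqrt 6 * d1) (2 * real_of_int d2) \<longleftrightarrow> real_of_int d3 \<le> sqrt 6 * d1 \<and> d3 \<le> 2 * d2"
    "real_of_int d3 \<le> min (2 * real_of_int d1) (sqrt 6 * d2) \<longleftrightarrow> d3 \<le> 2 * d1 \<and> real_of_int d3 \<le> sqrt 6 * d2"
    "max d1 d3 \<le> 2 * d2 \<longleftrightarrow> d1 \<le> 2 * d2 \<and> d3 \<le> 2 * d2"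
    by linarith+
  \<comment> \<open>d1 = d2 = 1 would leave only d = 2, which is not 1 or -1 modulo 9.\<close>
  have big: "1 < d1 * d2" if "d3 \<le> 2 * d1 \<or> d3 \<le> 2 * d2"
  proof (rule ccontr)
    assume "\<not> 1 < d1 * d2"
    then have "d1 * d2 = 1" using p mult_pos_pos[of d1 d2] by linarith
    then have 1: "d1 = 1" "d2 = 1" using p zmult_eq_1_iff[of d1 d2] by auto
    then have "d \<le> 2" using that assms(12) by simp
    then have "d = 2" using assms(1) by simp
    then show False using d9 by (simp add: cong_def)
  qed
  show ?thesis
  proof (intro conjI[where P = "_ \<longrightarrow> _"] impI; elim conjE)
    assume lt: "d1 ^ 2 < d2 * d3"
    assume "[d1 = d2] (mod 3) \<and> [d2 = - d3] (mod 3) \<and> d3 \<le> 2 * min d1 d2 \<or>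
           [d1 = - d2] (mod 3) \<and> [- d2 = d3] (mod 3) \<and>
             real_of_int d3 \<le> min (sqrt 6 * real_of_int d1) (2 * real_of_int d2) \<or>
           [- d1 = d3] (mod 3) \<and> [d3 = d2] (mod 3) \<and>
             real_of_int d3 \<le> min (2 * real_of_int d1) (sqrt 6 * real_of_int d2)"
    \<comment> \<open>For \<alpha>^2/d2 the divisors d1 and d2 change places: the first condition is
      preserved, while the second and third are exchanged.\<close>
    then have crit: "[d1 = d2] (mod 3) \<and> [d1 = - d3] (mod 3) \<and> d3 \<le> 2 * d1 \<and> d3 \<le> 2 * d2 \<or>
       [d1 = - d2] (mod 3) \<and> [d1 = d3] (mod 3) \<and> real_of_int d3 \<le> sqrt 6 * d1 \<and> d3 \<le> 2 * d2 \<or>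
       [d1 = - d2] (mod 3) \<and> [d1 = - d3] (mod 3) \<and> d3 \<le> 2 * d1 \<and> real_of_int d3 \<le> sqrt 6 * d2"
      and crit': "[d2 = d1] (mod 3) \<and> [d2 = - d3] (mod 3) \<and> d3 \<le> 2 * d2 \<and> d3 \<le> 2 * d1 \<or>
       [d2 = - d1] (mod 3) \<and> [d2 = d3] (mod 3) \<and> real_of_int d3 \<le> sqrt 6 * d2 \<and> d3 \<le> 2 * d1 \<or>
       [d2 = - d1] (mod 3) \<and> [d2 = - d3] (mod 3) \<and> d3 \<le> 2 * d2 \<and> real_of_int d3 \<le> sqrt 6 * d1"
      unfolding min using cong cong' cong'' by blast+
    have m1: "\<alpha> \<notin> Minima"
      by (rule ambiguous_gen_not_Minima_largest[OF d9 g assms(14) lt assms(15) crit])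
    have m2: "\<alpha>\<^sup>2 / real_of_int d2 \<notin> Minima"
      using assms(15) by (intro ambiguous_gen_not_Minima_largest[OF d9 g' lt assms(14) _ crit']) (simp add: mult.commute)
    have "M0_field \<delta> \<zeta> \<sigma>"
    proof (rule M0_fieldI[OF assms(7) g assms(14,15) big m1 g' lt _ m2])
      show "\<alpha>\<^sup>2 = of_int d2 * \<delta> ^ 0 * (\<alpha>\<^sup>2 / real_of_int d2)" using p by simp
    qed (use p crit assms(15) in \<open>auto simp: mult.commute\<close>)
    then show "M0_field \<delta> \<zeta> \<sigma> \<and> \<alpha> \<notin> Minima \<and> \<alpha> ^ 2 / real_of_int d2 \<notin> Minima" using m1 m2 by blast
  next
    assume lt: "d2 * d3 < d1 ^ 2"
    assume "[d1 = d2] (mod 3) \<and> [d2 = - d3] (mod 3) \<and>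
             real_of_int d1 \<le> sqrt 6 * real_of_int d2 \<and> d3 \<le> 2 * d2 \<or>
           [d1 = - d2] (mod 3) \<and> [- d2 = d3] (mod 3) \<and> max d1 d3 \<le> 2 * d2 \<or>
           [- d1 = d3] (mod 3) \<and> [d3 = d2] (mod 3) \<and>
             d1 \<le> 2 * d2 \<and> real_of_int d3 \<le> sqrt 6 * real_of_int d2"
    \<comment> \<open>For \<alpha>^2 \<delta>/(d1 d2) the divisors d1 and d3 change places: the
      second condition is preserved, while the first and third are exchanged.\<close>
    then have crit: "[d1 = d2] (mod 3) \<and> [d1 = - d3] (mod 3) \<and> real_of_int d1 \<le> sqrt 6 * d2 \<and> d3 \<le> 2 * d2 \<or>
       [d1 = - d2] (mod 3) \<and> [d1 = d3] (mod 3) \<and> d1 \<le> 2 * d2 \<and> d3 \<le> 2 * d2 \<or>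
       [d1 = - d2] (mod 3) \<and> [d1 = - d3] (mod 3) \<and> d1 \<le> 2 * d2 \<and> real_of_int d3 \<le> sqrt 6 * d2"
      and crit': "[d3 = d2] (mod 3) \<and> [d3 = - d1] (mod 3) \<and> real_of_int d3 \<le> sqrt 6 * d2 \<and> d1 \<le> 2 * d2 \<or>
       [d3 = - d2] (mod 3) \<and> [d3 = d1] (mod 3) \<and> d3 \<le> 2 * d2 \<and> d1 \<le> 2 * d2 \<or>
       [d3 = - d2] (mod 3) \<and> [d3 = - d1] (mod 3) \<and> d3 \<le> 2 * d2 \<and> real_of_int d1 \<le> sqrt 6 * d2"
      unfolding min using cong cong' cong'' by blast+
    have b: "1 < d1 * d2"
    proof -
      have "1 * 1 \<le> d2 * d3" using p by (intro mult_mono) auto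
      then have "1 < d1\<^sup>2" using lt by simp
      then have "1 < d1" using p by (simp add: power2_eq_square) (smt (verit) mult_le_one)
      then show ?thesis using p by (simp add: less_1_mult')
    qed
    have c: "d3 * d2 < d1\<^sup>2" "d2\<^sup>2 < d3 * d1" "d2 * d1 < d3\<^sup>2"
      using lt assms(14,15) by (simp_all add: mult.commute)
    have m1: "\<alpha> \<notin> Minima"
      by (rule ambiguous_gen_not_Minima_smallest[OF d9 g assms(14) lt assms(15) crit])
    have m2: "\<alpha>\<^sup>2 / real_of_int d2 * \<delta> / real_of_int d1 \<notin> Minima"
      by (rule ambiguous_gen_not_Minima_smallest[OF d9 g'' c(2,3,1) crit'])
    have "M0_field \<delta> \<zeta> \<sigma>"
    proof (rule M0_fieldI[OF assms(7) g assms(14,15) b m1 g'' c(2,1) m2])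
      \<comment> \<open>Undoing the factor \<delta> costs \<delta>^2 / d, hence the exponent 2 and
        the constant d1 d2 / d.\<close>
      have "of_int (d2 * d1) / of_int d * \<delta> ^ 2 * (\<alpha>\<^sup>2 / real_of_int d2 * \<delta> / real_of_int d1) =
          \<alpha>\<^sup>2 * (\<delta> ^ 3 / of_int d)"
        using p by (simp add: power2_eq_square power3_eq_cube)
      then show "\<alpha>\<^sup>2 = of_int (d2 * d1) / of_int d * \<delta> ^ 2 * (\<alpha>\<^sup>2 / real_of_int d2 * \<delta> / real_of_int d1)"
        using assms(1) by (simp add: delta3)
    qed (use p assms(1) in auto)
    then show "M0_field \<delta> \<zeta> \<sigma> \<and> \<alpha> \<notin> Minima \<and> \<alpha> ^ 2 / real_of_int d2 * \<delta> / real_of_int d1 \<notin> Minima"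
      using m1 m2 by blast
  qed
qed

end
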